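(* Let $(X,d)$ be a proper metric space, $(\cdot\mid\cdot)$ a controlled product on $(X,d)$, $\overline{X}$ the Gromov compactification of $X$ with respect to $(\cdot\mid\cdot)$, and $\partial X$ its Gromov boundary. Then $\overline{X}$ is a coarse compactification of $X$ and $\partial X$ is a corona of $X$.
   Context: A metric space is proper if every closed bounded subset is compact. $\mathbb{R}_{\geq 0}$ is the set of non-negative reals and $\mathbb{N}$ the set of positive integers. Controlled product. For a metric space $(X,d)$ and a base point $x_0\in X$, a symmetric function $(\cdot\mid\cdot):X\times X\to\mathbb{R}_{\geq 0}$ is a controlled product on $X$ if: (CP1) there is a non-decreasing $\rho_1:\mathbb{R}_{\geq 0}\to\mathbb{R}_{\geq 0}$ with $\min\{(x\mid y),(y\mid z)\}\leq\rho_1((x\mid z))$ for all $x,y,z\in X$; (CP2) there is a non-decreasing $\rho_2:\mathbb{R}_{\geq 0}\to\mathbb{R}_{\geq 0}$ with $(x\mid y)\leq\rho_2(d(x_0,x))$ for all $x,y\in X$; (CP3) there is a function $\rho_3:\mathbb{R}_{\geq 0}\times\mathbb{R}_{\geq 0}\to\mathbb{R}_{\geq 0}$, non-decreasing in the sense that $\rho_3(s_1,t_1)\leq\rho_3(s_2,t_2)$ whenever $s_1\leq s_2$ and $t_1\leq t_2$, with $d(x_0,x)\leq\rho_3((x\mid y),d(x,y))$ for all $x,y\in X$; (CP4) there is a non-decreasing $\rho_4:\mathbb{R}_{\geq 0}\to\mathbb{R}_{\geq 0}$ such that for every $R\geq 0$ and every $x\in X$ with $d(x_0,x)>\rho_4(R)$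 there is $y\in X$ with $d(x_0,y)\leq\rho_4(R)$ and $(x\mid y)\geq R$. These conditions do not depend on the choice of $x_0\in X$. Gromov compactification. $S_\infty(X)$ is the set of sequences $(x_i)$ in $X$ with $(x_i\mid x_j)\to\infty$ as $i,j\to\infty$. For $(x_i),(y_i)\in S_\infty(X)$ put $(x_i)\sim(y_i)$ iff $(x_i\mid y_i)\to\infty$ as $i\to\infty$; this is an equivalence relation. The Gromov boundary is $\partial X=S_\infty(X)/\sim$, and $\overline{X}=X\cup\partial X$ (disjoint union). For $x\in X$ and a sequence $(x_i)$ in $X$, write $(x_i)\in x$ if $x_i=x$ for all $i$; for $x\in\partial X$, $(x_i)\in x$ means $(x_i)$ belongs to the class $x$. Extend the product to $\overline{X}\times\overline{X}\to\mathbb{R}_{\geq 0}\cup\{\infty\}$ by $(x\mid y)=\inf\{\liminf_{i\to\infty}(x_i\mid y_i):(x_i)\in x,\ (y_i)\in y\}$. For $n\in\mathbb{N}$ let $V_n=\{(x,y)\in\overline{X}\times\overline{X}:(x\mid y)>n\}\cup\{(x,y)\in X\times X:d(x,y)<1/n\}$. The family $\{V_n\}$ is a base of a metrizable uniformity on $\overline{X}$, and $\overline{X}$ carries the induced topology: the sets $V_n[x]=\{y\in\overline{X}:(y,x)\in V_n\}$ form a neighbourhood base at $x$. When $X$ is proper and $(\cdot\mid\cdot)$ is a controlled product, $\overline{X}$ is a compactification of $X$, called the Gromov compactification with respect to $(\cdot\mid\cdot)$. Coarse compactification. A bounded continuous function $f:X\to\mathbb{C}$ is a Higson function if for every $\varepsilon>0$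 and $R>0$ there is a bounded subset $B\subset X$ such that $|f(x)-f(y)|<\varepsilon$ for all $x,y\in X\setminus B$ with $d(x,y)<R$. The Higson compactification $hX$ is the compactification of $X$ such that $C(hX)$ is naturally isomorphic (by restriction to $X$) to the $C^*$-algebra $C_h(X)$ of all Higson functions. A compactification $cX$ of $X$ is a coarse compactification if it is metrizable and there is a continuous map $f:hX\to cX$ with $f|_X=\mathrm{id}_X$; its boundary $cX\setminus X$ is then called a corona of $X$. *)

theory Defs
  imports "HOL-Analysis.Analysis"
begin

section \<open>Controlled products\<close>

text \<open>The functions \<open>\<rho>\<^sub>i\<close> live on the non-negative reals; they are represented by functions on the
  reals of which only the restriction to \<open>{0..}\<close> matters.\<close>

definition controlled_product :: "'a::metric_space \<Rightarrow> ('a \<Rightarrow> 'a \<Rightarrow> real) \<Rightarrow> bool" where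
  "controlled_product x0 P \<longleftrightarrow>
     (\<forall>x y. P x y = P y x) \<and> (\<forall>x y. 0 \<le> P x y) \<and>
     (\<exists>\<rho>. (\<forall>t\<ge>0. 0 \<le> \<rho> t) \<and> mono_on {0..} \<rho> \<and>
        (\<forall>x y z. min (P x y) (P y z) \<le> \<rho> (P x z))) \<and>
     (\<exists>\<rho>. (\<forall>t\<ge>0. 0 \<le> \<rho> t) \<and> mono_on {0..} \<rho> \<and>
        (\<forall>x y. P x y \<le> \<rho> (dist x0 x))) \<and>
     (\<exists>\<rho>. (\<forall>s\<ge>0. \<forall>t\<ge>0. 0 \<le> \<rho> s t) \<and>
        (\<forall>s1\<ge>0. \<forall>t1\<ge>0. \<forall>s2\<ge>s1. \<forall>t2\<ge>t1. \<rho> s1 t1 \<le> \<rho> s2 t2) \<and>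
        (\<forall>x y. dist x0 x \<le> \<rho> (P x y) (dist x y))) \<and>
     (\<exists>\<rho>. (\<forall>t\<ge>0. 0 \<le> \<rho> t) \<and> mono_on {0..} \<rho> \<and>
        (\<forall>R\<ge>0. \<forall>x. dist x0 x > \<rho> R \<longrightarrow> (\<exists>y. dist x0 y \<le> \<rho> R \<and> P x y \<ge> R)))"

section \<open>The Gromov compactification\<close>

definition gromov_seqs :: "('a \<Rightarrow> 'a \<Rightarrow> real) \<Rightarrow> (nat \<Rightarrow> 'a) set" where
  "gromov_seqs P =
     {xs. filterlim (\<lambda>(i, j). P (xs i) (xs j)) at_top (sequentially \<times>\<^sub>F sequentially)}"

definition gromov_rel :: "('a \<Rightarrow> 'a \<Rightarrow> real) \<Rightarrow> ((nat \<Rightarrow> 'a) \<times> (nat \<Rightarrow> 'a)) set" where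
  "gromov_rel P =
     {(xs, ys). xs \<in> gromov_seqs P \<and> ys \<in> gromov_seqs P \<and>
        filterlim (\<lambda>i. P (xs i) (ys i)) at_top sequentially}"

definition gromov_boundary :: "('a \<Rightarrow> 'a \<Rightarrow> real) \<Rightarrow> (nat \<Rightarrow> 'a) set set" where
  "gromov_boundary P = gromov_seqs P // gromov_rel P"

text \<open>The disjoint union of \<open>X\<close> and its boundary is a subset of a sum type:
  \<open>Inl x\<close> is the point \<open>x\<close> of \<open>X\<close> and \<open>Inr c\<close> the boundary point given by the class \<open>c\<close>.\<close>

type_synonym 'a gromov_point = "'a + (nat \<Rightarrow> 'a) set"

definition gromov_closure :: "('a \<Rightarrow> 'a \<Rightarrow> real) \<Rightarrow> 'a gromov_point set" where
  "gromov_closure P = range Inl \<union> Inr ` gromov_boundary P"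

fun seqs_of :: "'a gromov_point \<Rightarrow> (nat \<Rightarrow> 'a) set" where
  "seqs_of (Inl x) = {\<lambda>i. x}"
| "seqs_of (Inr c) = c"

definition ext_product :: "('a \<Rightarrow> 'a \<Rightarrow> real) \<Rightarrow> 'a gromov_point \<Rightarrow> 'a gromov_point \<Rightarrow> ereal" where
  "ext_product P p q =
     (INF (xs, ys) \<in> seqs_of p \<times> seqs_of q. liminf (\<lambda>i. ereal (P (xs i) (ys i))))"

definition gromov_entourage ::
    "('a::metric_space \<Rightarrow> 'a \<Rightarrow> real) \<Rightarrow> nat \<Rightarrow> ('a gromov_point \<times> 'a gromov_point) set" where
  "gromov_entourage P n =
     {(p, q) \<in> gromov_closure P \<times> gromov_closure P. ext_product P p q > ereal (real n)} \<union>
     {(Inl x, Inl y) | x y. dist x y < 1 / real n}"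

text \<open>The topology induced by the uniformity with base \<open>gromov_entourage P n\<close>, \<open>n \<ge> 1\<close>.\<close>

definition gromov_topology :: "('a::metric_space \<Rightarrow> 'a \<Rightarrow> real) \<Rightarrow> 'a gromov_point topology" where
  "gromov_topology P = topology (\<lambda>U. U \<subseteq> gromov_closure P \<and>
     (\<forall>p\<in>U. \<exists>n\<ge>1. {q. (q, p) \<in> gromov_entourage P n} \<subseteq> U))"

lemma gromov_entourage_antimono:
  assumes "1 \<le> m" "m \<le> n" "(p, q) \<in> gromov_entourage P n"
  shows "(p, q) \<in> gromov_entourage P m"
proof -
  have 1: "1 / real n \<le> 1 / real m"
    using assms by (simp add: frac_le)
  have 2: "ereal (real m) \<le> ereal (real n)"
    using assms by simp
  consider "p \<in> gromov_closure P" "q \<in> gromov_closure P" "ext_product P p q > ereal (real n)"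
    | x y where "p = Inl x" "q = Inl y" "dist x y < 1 / real n"
    using assms(3) unfolding gromov_entourage_def by blast
  then show ?thesis
  proof cases
    case 1
    then show ?thesis
      using le_less_trans[OF 2 1(3)] unfolding gromov_entourage_def by simp
  next
    case 2
    then show ?thesis
      using less_le_trans[OF 2(3) 1] unfolding gromov_entourage_def by simp
  qed
qed

lemma openin_gromov_topology:
  "openin (gromov_topology P) U \<longleftrightarrow> U \<subseteq> gromov_closure P \<and>
     (\<forall>p\<in>U. \<exists>n\<ge>1. {q. (q, p) \<in> gromov_entourage P n} \<subseteq> U)"
proof -
  define op where "op U \<longleftrightarrow> U \<subseteq> gromov_closure P \<and>
     (\<forall>p\<in>U. \<exists>n\<ge>1. {q. (q, p) \<in> gromov_entourage P n} \<subseteq> U)" for U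
  have "op (S \<inter> T)" if S: "op S" and T: "op T" for S T
    unfolding op_def
  proof (intro conjI ballI)
    show "S \<inter> T \<subseteq> gromov_closure P" using S unfolding op_def by blast
    fix p assume p: "p \<in> S \<inter> T"
    obtain m where m: "m \<ge> 1" "{q. (q, p) \<in> gromov_entourage P m} \<subseteq> S"
      using S p unfolding op_def by blast
    obtain n where n: "n \<ge> 1" "{q. (q, p) \<in> gromov_entourage P n} \<subseteq> T"
      using T p unfolding op_def by blast
    have "{q. (q, p) \<in> gromov_entourage P (max m n)} \<subseteq> S \<inter> T"
    proof
      fix q assume "q \<in> {q. (q, p) \<in> gromov_entourage P (max m n)}"
      then have "(q, p) \<in> gromov_entourage P (max m n)" by simp
      then have "(q, p) \<in> gromov_entourage P m" "(q, p) \<in> gromov_entourage P n"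
        using gromov_entourage_antimono m(1) n(1) max.cobounded1 max.cobounded2 by metis+
      then show "q \<in> S \<inter> T" using m(2) n(2) by blast
    qed
    moreover have "max m n \<ge> 1" using m(1) by simp
    ultimately show "\<exists>k\<ge>1. {q. (q, p) \<in> gromov_entourage P k} \<subseteq> S \<inter> T"
      by blast
  qed
  moreover have "op (\<Union>\<K>)" if K: "\<forall>K\<in>\<K>. op K" for \<K>
    unfolding op_def
  proof (intro conjI ballI)
    show "\<Union>\<K> \<subseteq> gromov_closure P" using K unfolding op_def by blast
    fix p assume "p \<in> \<Union>\<K>"
    then obtain K where "K \<in> \<K>" "p \<in> K" by blast
    moreover from this obtain n where "n \<ge> 1" "{q. (q, p) \<in> gromov_entourage P n} \<subseteq> K"
      using K unfolding op_def by blast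
    ultimately show "\<exists>n\<ge>1. {q. (q, p) \<in> gromov_entourage P n} \<subseteq> \<Union>\<K>" by blast
  qed
  ultimately have "istopology op"
    unfolding istopology_def by blast
  moreover have "gromov_topology P = topology op"
    unfolding gromov_topology_def op_def ..
  ultimately have "openin (gromov_topology P) U \<longleftrightarrow> op U"
    by (metis topology_inverse')
  then show ?thesis
    unfolding op_def .
qed

lemma topspace_gromov_topology: "topspace (gromov_topology P) = gromov_closure P"
proof
  show "topspace (gromov_topology P) \<subseteq> gromov_closure P"
    using openin_gromov_topology[of P "topspace (gromov_topology P)"] by simp
  have "{q. (q, p) \<in> gromov_entourage P 1} \<subseteq> gromov_closure P" for p
    unfolding gromov_entourage_def gromov_closure_def by blast
  then have "openin (gromov_topology P) (gromov_closure P)"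
    unfolding openin_gromov_topology by blast
  then show "gromov_closure P \<subseteq> topspace (gromov_topology P)"
    by (rule openin_subset)
qed

section \<open>Coarse compactifications\<close>

text \<open>A compactification is a compact Hausdorff space \<open>K\<close> together with the embedding \<open>e\<close> of \<open>X\<close>
  onto a dense subspace by which points of \<open>X\<close> are regarded as points of \<open>K\<close>.\<close>

definition compactification :: "'a topology \<Rightarrow> 'b topology \<Rightarrow> ('a \<Rightarrow> 'b) \<Rightarrow> bool" where
  "compactification X K e \<longleftrightarrow>
     compact_space K \<and> Hausdorff_space K \<and> embedding_map X K e \<and>
     K closure_of (e ` topspace X) = topspace K"

definition higson_function :: "('a::metric_space \<Rightarrow> complex) \<Rightarrow> bool" where
  "higson_function f \<longleftrightarrow>
     bounded (range f) \<and> continuous_on UNIV f \<and>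
     (\<forall>\<epsilon>>0. \<forall>R>0. \<exists>B. bounded B \<and>
        (\<forall>x y. x \<notin> B \<longrightarrow> y \<notin> B \<longrightarrow> dist x y < R \<longrightarrow> cmod (f x - f y) < \<epsilon>))"

text \<open>Restriction along \<open>e\<close> commutes with the pointwise operations, so it is an isomorphism
  of \<open>C(K)\<close> onto the algebra of Higson functions as soon as it is a bijection.
  Extensionality makes the functions on \<open>topspace K\<close> correspond to unique HOL functions.\<close>

definition higson_compactification :: "'b topology \<Rightarrow> ('a::metric_space \<Rightarrow> 'b) \<Rightarrow> bool" where
  "higson_compactification K e \<longleftrightarrow>
     compactification euclidean K e \<and>
     bij_betw (\<lambda>g. g \<circ> e)
       {g \<in> extensional (topspace K). continuous_map K euclidean g}
       {f. higson_function f}"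

text \<open>The Higson compactification is unique up to a homeomorphism fixing \<open>X\<close>, so it does not matter
  which one is used.  It is taken on the type \<open>('a \<Rightarrow> complex) \<Rightarrow> complex\<close>, which accommodates
  it: the closure of the image of \<open>X\<close> under evaluation in the product of copies of the complex plane
  indexed by the Higson functions.\<close>

definition coarse_compactification :: "'b topology \<Rightarrow> ('a::metric_space \<Rightarrow> 'b) \<Rightarrow> bool" where
  "coarse_compactification K c \<longleftrightarrow>
     compactification euclidean K c \<and> metrizable_space K \<and>
     (\<exists>(H :: (('a \<Rightarrow> complex) \<Rightarrow> complex) topology) h f.
        higson_compactification H h \<and> continuous_map H K f \<and> (\<forall>x. f (h x) = c x))"

text \<open>The type argument names the space \<open>X\<close> of which \<open>N\<close> is a corona.\<close>

definition corona :: "'a::metric_space itself \<Rightarrow> 'b topology \<Rightarrow> bool" where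
  "corona X N \<longleftrightarrow>
     (\<exists>K (c :: 'a \<Rightarrow> 'b). coarse_compactification K c \<and>
        N = subtopology K (topspace K - range c))"

end

(* The sets V_n are a countable base of a separated uniformity, which is induced by a metric d on the
   Gromov compactification.  This metric is totally bounded by (CP4) and properness, and complete
   because a d-Cauchy sequence of X either returns infinitely often to a bounded set or has products
   tending to infinity; so the space is compact.  By (CP3), x |-> d q x is a Higson function for
   every point q, so a point z of the Higson compactification prescribes a distance to every q.
   Compactness yields a point with these distances; sending z to it is the required continuous map. *)

theory Submission
  imports Defs
begin

section \<open>Metrization of a countable uniformity\<close>

text \<open>The definition of a coarse compactification asks for some Higson compactification, so
  one has to be exhibited in full. The closure of the evaluation image is compact and extends every
  Higson function almost by construction; the costly half is that every continuous function on it
  restricts to a Higson function. A metric on the Gromov side is what makes the map definable: the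
  functions \<open>d q\<close> are Kuratowski coordinates, so the distances prescribed by a Higson
  point determine its image, and closeness to an image point is a condition on the one coordinate
  belonging to that point. The entourages mix large products with small distances, two unrelated
  kinds of nearness; they fit together because (CP2) and (CP3) turn a short step taken far out into
  a large product. Since (CP1) gives no convenient rate, the entourages are thinned before they are
  metrized, and afterwards only qualitative comparisons with the metric remain.\<close>

text \<open>Induction on the length: remove the edge at which the partial sums pass half of the total; the
  two remaining pieces carry at most half each.\<close>

lemma chain_sum_bound:
  fixes f :: "'b \<Rightarrow> 'b \<Rightarrow> real"
  assumes nonneg: "\<And>p q. 0 \<le> f p q" and refl: "\<And>p. f p p = 0"
    and comp3: "\<And>p q r s c. f p q \<le> c \<Longrightarrow> f q r \<le> c \<Longrightarrow> f r s \<le> c \<Longrightarrow> f p s \<le> 2 * c"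
  shows "f (x 0) (x k) \<le> 2 * (\<Sum>i<k. f (x i) (x (Suc i)))"
proof (induction k arbitrary: x rule: less_induct)
  case (less k)
  define S where "S = (\<Sum>i<k. f (x i) (x (Suc i)))"
  define T where "T j = (\<Sum>i<j. f (x i) (x (Suc i)))" for j
  have S0: "S \<ge> 0" unfolding S_def by (simp add: nonneg sum_nonneg)
  show ?case
  proof (cases "k = 0")
    case True
    then show ?thesis by (simp add: refl)
  next
    case False
    define j where "j = (GREATEST j. j < k \<and> T j \<le> S / 2)"
    have j: "j < k \<and> T j \<le> S / 2"
      unfolding j_def
      by (rule GreatestI_nat[where k=0 and b=k]) (use False S0 in \<open>auto simp: T_def\<close>)
    have jmax: "i \<le> j" if "i < k" "T i \<le> S / 2" for i
      unfolding j_def by (rule Greatest_le_nat[where b=k]) (use that in auto)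
    have split: "S = T (Suc j) + (\<Sum>i<k - Suc j. f (x (i + Suc j)) (x (Suc (i + Suc j))))"
    proof -
      have "S = T (Suc j) + (\<Sum>i=Suc j..<k. f (x i) (x (Suc i)))"
        unfolding S_def T_def using j
        by (metis Suc_leI atLeast0LessThan sum.atLeastLessThan_concat zero_le)
      also have "(\<Sum>i=Suc j..<k. f (x i) (x (Suc i))) =
          (\<Sum>i=0..<k - Suc j. f (x (i + Suc j)) (x (Suc (i + Suc j))))"
        using sum.shift_bounds_nat_ivl[of "\<lambda>i. f (x i) (x (Suc i))" 0 "Suc j" "k - Suc j"] j
        by simp
      finally show ?thesis by (simp add: atLeast0LessThan)
    qed
    \<comment> \<open>The factor 2 of the induction hypothesis turns a piece of weight
      \<open>S / 2\<close> into the bound \<open>S\<close>, so one constant serves all three steps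
      of \<open>comp3\<close>.\<close>
    have a: "f (x 0) (x j) \<le> S"
      using less.IH[of j x] j unfolding T_def by linarith
    have b: "f (x j) (x (Suc j)) \<le> S"
    proof -
      have "f (x j) (x (Suc j)) \<le> (\<Sum>i<k. f (x i) (x (Suc i)))"
        by (rule member_le_sum) (use j nonneg in auto)
      then show ?thesis unfolding S_def .
    qed
    have c: "f (x (Suc j)) (x k) \<le> S"
    proof (cases "Suc j = k")
      case True
      then show ?thesis using S0 by (simp add: refl)
    next
      case False
      then have "\<not> T (Suc j) \<le> S / 2" using jmax[of "Suc j"] j by auto
      then have "(\<Sum>i<k - Suc j. f (x (i + Suc j)) (x (Suc (i + Suc j)))) \<le> S / 2"
        using split by linarith
      then show ?thesis
        using less.IH[of "k - Suc j" "\<lambda>i. x (i + Suc j)"] j by simp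
    qed
    show ?thesis using comp3[OF a b c] unfolding S_def .
  qed
qed

text \<open>The gauge \<open>f\<close> measures how deep in the sequence a pair lies, but it
  violates the triangle inequality. The infimum \<open>d\<close> of its chain sums satisfies it, and
  \<open>chain_sum_bound\<close> keeps \<open>f\<close> below \<open>2 * d\<close>, so small values
  of \<open>d\<close> still detect the entourages.\<close>

lemma nested_entourages_pseudometric:
  fixes U :: "nat \<Rightarrow> ('b \<times> 'b) set"
  assumes U0: "U 0 = UNIV" and refl: "\<And>n. Id \<subseteq> U n" and sym: "\<And>n. sym (U n)"
    and comp: "\<And>n. U (Suc n) O U (Suc n) O U (Suc n) \<subseteq> U n"
  obtains d :: "'b \<Rightarrow> 'b \<Rightarrow> real" where
    "\<And>p q. 0 \<le> d p q" "\<And>p q. d p q = d q p" "\<And>p. d p p = 0"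
    "\<And>p q r. d p r \<le> d p q + d q r" "\<And>p q. d p q \<le> 1"
    "\<And>n p q. d p q < (1/2)^(Suc n) \<Longrightarrow> (p, q) \<in> U n"
    "\<And>n p q. (p, q) \<in> U n \<Longrightarrow> d p q \<le> (1/2)^n"
proof -
  have Suc_sub: "U (Suc n) \<subseteq> U n" for n
  proof
    fix z assume z: "z \<in> U (Suc n)"
    obtain p q where pq: "z = (p, q)" by (cases z)
    have "(p, p) \<in> U (Suc n)" "(q, q) \<in> U (Suc n)" using refl[of "Suc n"] by auto
    then have "(p, q) \<in> U (Suc n) O U (Suc n) O U (Suc n)"
      using z unfolding pq by (intro relcompI)
    then show "z \<in> U n" using comp[of n] unfolding pq by (rule rev_subsetD)
  qed
  have anti: "U n \<subseteq> U m" if "m \<le> n" for m n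
    using lift_Suc_antimono_le[of U, OF Suc_sub that] .
  define f :: "'b \<Rightarrow> 'b \<Rightarrow> real" where "f p q = (INF n\<in>{n. (p, q) \<in> U n}. (1/2)^n)" for p q
  have bdd: "bdd_below ((\<lambda>n. (1/2::real)^n) ` A)" for A :: "nat set"
    by (rule bdd_belowI[of _ 0]) auto
  have ne: "{n. (p, q) \<in> U n} \<noteq> {}" for p q using U0 by blast
  have f_le: "f p q \<le> (1/2)^n" if "(p, q) \<in> U n" for p q n
    unfolding f_def by (rule cINF_lower) (use that bdd in auto)
  \<comment> \<open>The gauge is an infimum of powers of 1/2, so a strict inequality gains one
    index. This pays for the index that \<open>comp\<close> loses in \<open>comp3\<close>.\<close>
  have f_less: "(p, q) \<in> U (Suc n)" if "f p q < (1/2)^n" for p q n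
  proof -
    obtain m where "(p, q) \<in> U m" "(1/2::real)^m < (1/2)^n"
      using \<open>f p q < (1/2)^n\<close> unfolding f_def cINF_less_iff[OF ne bdd] by blast
    moreover from this(2) have "n < m" by simp
    ultimately show ?thesis using anti[of "Suc n" m] by auto
  qed
  have f0: "0 \<le> f p q" for p q
    unfolding f_def by (rule cINF_greatest[OF ne]) auto
  have f1: "f p q \<le> 1" for p q using f_le[of p q 0] U0 by simp
  have small0: "t \<le> 0" if "\<And>n. t \<le> (1/2)^n" for t :: real
    by (rule LIMSEQ_le_const[OF LIMSEQ_realpow_zero[of "1/2"]]) (use that in auto)
  have frefl: "f p p = 0" for p
  proof -
    have "f p p \<le> (1/2)^n" for n using f_le[of p p n] refl by blast
    then show ?thesis using small0 f0 by (simp add: order_antisym)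
  qed
  have fsym: "f p q = f q p" for p q
  proof -
    have "{n. (p, q) \<in> U n} = {n. (q, p) \<in> U n}" using sym by (auto dest: symD)
    then show ?thesis unfolding f_def by simp
  qed
  have comp3: "f p s \<le> 2 * c" if c: "f p q \<le> c" "f q r \<le> c" "f r s \<le> c" for p q r s c
  proof -
    have step: "f p s \<le> (1/2)^n" if "c < (1/2)^n" for n
    proof (rule f_le)
      have "(p, q) \<in> U (Suc n)" "(q, r) \<in> U (Suc n)" "(r, s) \<in> U (Suc n)"
        by (rule f_less, use c that in linarith)+
      then have "(p, s) \<in> U (Suc n) O U (Suc n) O U (Suc n)" by (intro relcompI)
      then show "(p, s) \<in> U n" using comp[of n] by (rule rev_subsetD)
    qed
    consider "c \<ge> 1" | "c < 1" "c > 0" | "c \<le> 0" by linarith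
    then show ?thesis
    proof cases
      case 1
      then show ?thesis using f1[of p s] by linarith
    next
      case 2
      obtain k0 where "(1/2::real)^k0 < c"
        using real_arch_pow_inv[of c "1/2"] 2 by auto
      then have ex: "(1/2::real)^k0 \<le> c" by simp
      \<comment> \<open>Minimality of \<open>k\<close> puts the preceding power above
        \<open>c\<close> but at most at \<open>2 * c\<close>: the doubling in \<open>comp3\<close>
        is the ratio of consecutive powers of 1/2.\<close>
      define k where "k = (LEAST k. (1/2::real)^k \<le> c)"
      have k: "(1/2::real)^k \<le> c" unfolding k_def by (rule LeastI[of _ k0]) (rule ex)
      then obtain n where n: "k = Suc n" using 2 by (cases k) auto
      have "\<not> (1/2::real)^n \<le> c"
        using not_less_Least[of n "\<lambda>k. (1/2::real)^k \<le> c"] n unfolding k_def by simp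
      then have "f p s \<le> (1/2)^n" using step by simp
      moreover have "(1/2::real)^n \<le> 2 * c" using k n by simp
      ultimately show ?thesis by linarith
    next
      case 3
      then have "c = 0" using f0[of p q] c by linarith
      then show ?thesis using small0[of "f p s"] step by simp
    qed
  qed
  define L where "L p q = {\<Sum>i<k. f (x i) (x (Suc i)) | (x :: nat \<Rightarrow> 'b) (k :: nat). x 0 = p \<and> x k = q}"
    for p q
  define d where "d p q = Inf (L p q)" for p q
  have L0: "0 \<le> a" if "a \<in> L p q" for a p q
    using that unfolding L_def by (auto intro!: sum_nonneg f0)
  have Lbdd: "bdd_below (L p q)" for p q by (rule bdd_belowI[of _ 0]) (rule L0)
  have Lf: "f p q \<in> L p q" for p q
    unfolding L_def
    by (rule CollectI, rule exI[of _ "\<lambda>i. if i = 0 then p else q"], rule exI[of _ 1]) auto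
  then have Lne: "L p q \<noteq> {}" for p q by blast
  have dL: "d p q \<le> a" if "a \<in> L p q" for a p q
    unfolding d_def by (rule cInf_lower[OF that Lbdd])
  have Lf_le: "f p q \<le> 2 * a" if "a \<in> L p q" for a p q
  proof -
    have "f (x 0) (x k) \<le> 2 * (\<Sum>i<k. f (x i) (x (Suc i)))" for x :: "nat \<Rightarrow> 'b" and k
      by (rule chain_sum_bound[of f, OF f0 frefl], rule comp3)
    then show ?thesis using that unfolding L_def by auto
  qed
  have fd: "f p q \<le> 2 * d p q" for p q
  proof -
    have "f p q / 2 \<le> d p q"
      unfolding d_def
    proof (rule cInf_greatest[OF Lne])
      fix a assume "a \<in> L p q" then show "f p q / 2 \<le> a" using Lf_le[of a p q] by simp
    qed
    then show ?thesis by simp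
  qed
  have Lsym: "L p q \<subseteq> L q p" for p q
  proof
    fix a assume "a \<in> L p q"
    then obtain x k where x: "a = (\<Sum>i<k. f (x i) (x (Suc i)))" "x 0 = p" "x k = q"
      unfolding L_def by blast
    have "a = (\<Sum>i<k. f (x (k - Suc i)) (x (Suc (k - Suc i))))"
      unfolding x(1) by (rule sum.nat_diff_reindex[symmetric])
    also have "\<dots> = (\<Sum>i<k. f (x (k - i)) (x (k - Suc i)))"
      by (rule sum.cong) (auto simp: fsym Suc_diff_Suc)
    finally have "a = (\<Sum>i<k. f (x (k - i)) (x (k - Suc i)))" .
    then show "a \<in> L q p"
      unfolding L_def using x
      by (intro CollectI exI[of _ "\<lambda>i. x (k - i)"] exI[of _ k]) auto
  qed
  have Ladd: "a + b \<in> L p r" if "a \<in> L p q" "b \<in> L q r" for a b p q r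
  proof -
    obtain x k where x: "a = (\<Sum>i<k. f (x i) (x (Suc i)))" "x 0 = p" "x k = q"
      using \<open>a \<in> L p q\<close> unfolding L_def by blast
    obtain y l where y: "b = (\<Sum>i<l. f (y i) (y (Suc i)))" "y 0 = q" "y l = r"
      using \<open>b \<in> L q r\<close> unfolding L_def by blast
    define z where "z i = (if i \<le> k then x i else y (i - k))" for i
    have zy: "z (i + k) = y i" for i using x y unfolding z_def by auto
    have "(\<Sum>i<k + l. f (z i) (z (Suc i))) =
        (\<Sum>i<k. f (z i) (z (Suc i))) + (\<Sum>i=k..<k+l. f (z i) (z (Suc i)))"
      by (metis atLeast0LessThan le_add1 sum.atLeastLessThan_concat zero_le)
    also have "(\<Sum>i=k..<k+l. f (z i) (z (Suc i))) = (\<Sum>i<l. f (z (i + k)) (z (Suc i + k)))"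
      using sum.shift_bounds_nat_ivl[of "\<lambda>i. f (z i) (z (Suc i))" 0 k l]
      by (simp add: atLeast0LessThan add.commute)
    also have "\<dots> = b" unfolding zy y(1) ..
    also have "(\<Sum>i<k. f (z i) (z (Suc i))) = a"
      unfolding x(1) by (rule sum.cong) (auto simp: z_def)
    finally have "a + b = (\<Sum>i<k + l. f (z i) (z (Suc i)))" by simp
    moreover have "z 0 = p" "z (k + l) = r" using x y zy[of l] by (auto simp: z_def add.commute)
    ultimately show ?thesis unfolding L_def by blast
  qed
  have tri: "d p r \<le> d p q + d q r" for p q r
  proof -
    have "d p r - d p q \<le> b" if b: "b \<in> L q r" for b
    proof -
      have "d p r - b \<le> d p q"
        unfolding d_def[of p q]
      proof (rule cInf_greatest[OF Lne])
        fix a assume "a \<in> L p q" then show "d p r - b \<le> a" using dL[OF Ladd[OF _ b]] by fastforce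
      qed
      then show ?thesis by linarith
    qed
    then have "d p r - d p q \<le> d q r" unfolding d_def[of q r] using Lne by (intro cInf_greatest) auto
    then show ?thesis by linarith
  qed
  have d0: "0 \<le> d p q" for p q using fd[of p q] f0[of p q] by linarith
  have df: "d p q \<le> f p q" for p q by (rule dL[OF Lf])
  show ?thesis
  proof
    show "0 \<le> d p q" for p q by (rule d0)
    show "d p q = d q p" for p q unfolding d_def using Lsym by (metis order_antisym)
    show "d p p = 0" for p using df[of p p] d0[of p p] frefl by simp
    show "d p r \<le> d p q + d q r" for p q r by (rule tri)
    show "d p q \<le> 1" for p q using df f1 order_trans by blast
    show "(p, q) \<in> U n" if "d p q < (1/2)^(Suc n)" for n p q
    proof -
      have "f p q < (1/2)^n" using fd[of p q] that by simp
      then show ?thesis using f_less Suc_sub by blast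
    qed
    show "d p q \<le> (1/2)^n" if "(p, q) \<in> U n" for n p q
      using df f_le[OF that] order_trans by blast
  qed
qed

text \<open>The index \<open>m\<close> in \<open>comp\<close> is uncontrolled, so the sequence is
  thinned until a threefold composition costs exactly one index. The thinning depends on the given
  family, hence the purely qualitative form of the last two conclusions.\<close>

lemma countable_uniformity_pseudometric:
  fixes V :: "nat \<Rightarrow> ('b \<times> 'b) set"
  assumes refl: "\<And>n. Id \<subseteq> V n" and sym: "\<And>n. sym (V n)"
    and anti: "\<And>m n. m \<le> n \<Longrightarrow> V n \<subseteq> V m"
    and comp: "\<And>n. \<exists>m. V m O V m \<subseteq> V n"
  obtains d :: "'b \<Rightarrow> 'b \<Rightarrow> real" where
    "\<And>p q. 0 \<le> d p q" "\<And>p q. d p q = d q p" "\<And>p. d p p = 0"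
    "\<And>p q r. d p r \<le> d p q + d q r" "\<And>p q. d p q \<le> 1"
    "\<And>n. \<exists>e>0. \<forall>p q. d p q < e \<longrightarrow> (p, q) \<in> V n"
    "\<And>e. e > 0 \<Longrightarrow> \<exists>n. \<forall>p q. (p, q) \<in> V n \<longrightarrow> d p q < e"
proof -
  have "\<exists>m\<ge>n. V m O V m O V m \<subseteq> V n" for n
  proof -
    obtain l where l: "V l O V l \<subseteq> V n" using comp by blast
    obtain m where m: "V m O V m \<subseteq> V l" using comp by blast
    define k where "k = max n (max l m)"
    have "V k \<subseteq> V l" "V k \<subseteq> V m" unfolding k_def by (rule anti, simp)+
    then have "V k O V k O V k \<subseteq> V l O V m O V m" by (intro relcomp_mono)
    also have "\<dots> \<subseteq> V l O V l" by (intro relcomp_mono order_refl m)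
    also note l
    finally have "V k O V k O V k \<subseteq> V n" .
    moreover have "n \<le> k" unfolding k_def by simp
    ultimately show ?thesis by blast
  qed
  then obtain g where g: "\<And>n. g n \<ge> n" "\<And>n. V (g n) O V (g n) O V (g n) \<subseteq> V n" by metis
  \<comment> \<open>The \<open>Suc\<close> pushes the chosen indices to infinity, so the thinned
    entourages remain a base of the same uniformity.\<close>
  define r where "r k = ((\<lambda>n. g (Suc n)) ^^ k) 0" for k
  have rSuc: "r (Suc k) = g (Suc (r k))" for k unfolding r_def by simp
  have rk: "k \<le> r k" for k
  proof (induction k)
    case (Suc k)
    then show ?case using g(1)[of "Suc (r k)"] rSuc by simp
  qed simp
  define U where "U n = (case n of 0 \<Rightarrow> UNIV | Suc k \<Rightarrow> V (r k))" for n
  have U: "U 0 = UNIV" "U (Suc k) = V (r k)" for k unfolding U_def by auto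
  have c: "U (Suc n) O U (Suc n) O U (Suc n) \<subseteq> U n" for n
  proof (cases n)
    case (Suc k)
    have "V (Suc (r k)) \<subseteq> V (r k)" by (rule anti) simp
    with g(2)[of "Suc (r k)"] show ?thesis unfolding Suc U rSuc by (rule order_trans)
  qed (simp add: U)
  have a: "Id \<subseteq> U n" for n using refl[of "r (n - 1)"] by (cases n) (simp_all add: U)
  have b: "sym (U n)" for n using sym[of "r (n - 1)"] by (cases n) (simp_all add: U sym_def)
  show ?thesis
  proof (rule nested_entourages_pseudometric[OF U(1) a b c])
    fix d :: "'b \<Rightarrow> 'b \<Rightarrow> real"
    assume d:
      "\<And>p q. 0 \<le> d p q" "\<And>p q. d p q = d q p" "\<And>p. d p p = 0"
      "\<And>p q r. d p r \<le> d p q + d q r" "\<And>p q. d p q \<le> 1"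
      "\<And>n p q. d p q < (1/2)^(Suc n) \<Longrightarrow> (p, q) \<in> U n"
      "\<And>n p q. (p, q) \<in> U n \<Longrightarrow> d p q \<le> (1/2)^n"
    show ?thesis
    proof (rule that[OF d(1-5)])
      fix n
      have "(p, q) \<in> V n" if "d p q < (1/2)^(Suc (Suc n))" for p q
        using d(6)[OF that] anti[OF rk] unfolding U by blast
      then show "\<exists>e>0. \<forall>p q. d p q < e \<longrightarrow> (p, q) \<in> V n"
        by (intro exI[of _ "(1/2)^(Suc (Suc n))"]) auto
    next
      fix e :: real assume "e > 0"
      then obtain n where n: "(1/2)^n < e" using real_arch_pow_inv[of e "1/2"] by auto
      have "d p q < e" if "(p, q) \<in> V (r n)" for p q
      proof -
        have "d p q \<le> (1/2)^(Suc n)" using d(7)[of p q "Suc n"] that unfolding U by blast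
        also have "\<dots> \<le> (1/2)^n" by simp
        finally show ?thesis using n by linarith
      qed
      then show "\<exists>n. \<forall>p q. (p, q) \<in> V n \<longrightarrow> d p q < e" by blast
    qed
  qed
qed

section \<open>The Gromov uniformity\<close>

text \<open>The conditions (CP1)--(CP4) with the control functions eliminated.\<close>

locale controlled =
  fixes x0 :: "'a::metric_space" and P :: "'a \<Rightarrow> 'a \<Rightarrow> real"
  assumes P_sym: "P x y = P y x"
    and cp1: "\<exists>m. \<forall>x y z. P x y > m \<longrightarrow> P y z > m \<longrightarrow> P x z > s"
    and cp2: "\<exists>M. \<forall>x y. dist x0 x \<le> r \<longrightarrow> P x y \<le> M"
    and cp3: "\<exists>r. \<forall>x y. P x y \<le> s \<longrightarrow> dist x y \<le> t \<longrightarrow> dist x0 x \<le> r"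
    and cp4: "\<exists>r. \<forall>x. dist x0 x > r \<longrightarrow> (\<exists>y. dist x0 y \<le> r \<and> P x y \<ge> s)"

lemma controlled_product_imp_controlled:
  assumes "controlled_product x0 P"
  shows "controlled x0 P"
proof
  note cp = assms[unfolded controlled_product_def]
  have nonneg: "0 \<le> P x y" for x y using cp by (elim conjE) simp
  obtain \<rho>1 where \<rho>1: "mono_on {0..} \<rho>1" "\<And>x y z. min (P x y) (P y z) \<le> \<rho>1 (P x z)"
    using cp[THEN conjunct2, THEN conjunct2, THEN conjunct1] by blast
  obtain \<rho>2 where \<rho>2: "mono_on {0..} \<rho>2" "\<And>x y. P x y \<le> \<rho>2 (dist x0 x)"
    using cp[THEN conjunct2, THEN conjunct2, THEN conjunct2, THEN conjunct1] by blast
  obtain \<rho>3 where \<rho>3: "\<forall>s1\<ge>0. \<forall>t1\<ge>0. \<forall>s2\<ge>s1. \<forall>t2\<ge>t1. \<rho>3 s1 t1 \<le> \<rho>3 s2 t2"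
      "\<And>x y. dist x0 x \<le> \<rho>3 (P x y) (dist x y)"
    using cp[THEN conjunct2, THEN conjunct2, THEN conjunct2, THEN conjunct2, THEN conjunct1] by blast
  obtain \<rho>4 where \<rho>4: "\<forall>R\<ge>0. \<forall>x. dist x0 x > \<rho>4 R \<longrightarrow> (\<exists>y. dist x0 y \<le> \<rho>4 R \<and> P x y \<ge> R)"
    using cp[THEN conjunct2, THEN conjunct2, THEN conjunct2, THEN conjunct2, THEN conjunct2] by blast
  show "P x y = P y x" for x y using cp[THEN conjunct1] by blast
  show "\<exists>m. \<forall>x y z. P x y > m \<longrightarrow> P y z > m \<longrightarrow> P x z > s" for s
  proof (intro exI allI impI)
    \<comment> \<open>The control functions are monotone only on the non-negative reals, while
      \<open>s\<close> is arbitrary; hence the clipping by \<open>max s 0\<close>.\<close>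
    fix x y z assume a: "P x y > \<rho>1 (max s 0)" "P y z > \<rho>1 (max s 0)"
    show "P x z > s"
    proof (rule ccontr)
      assume "\<not> P x z > s"
      then have "\<rho>1 (P x z) \<le> \<rho>1 (max s 0)"
        using nonneg[of x z] by (intro mono_onD[OF \<rho>1(1)]) auto
      then show False using a \<rho>1(2)[of x y z] by linarith
    qed
  qed
  show "\<exists>M. \<forall>x y. dist x0 x \<le> r \<longrightarrow> P x y \<le> M" for r
  proof (intro exI allI impI)
    fix x y assume a: "dist x0 x \<le> r"
    have "\<rho>2 (dist x0 x) \<le> \<rho>2 r"
      using a order_trans[OF zero_le_dist a] by (intro mono_onD[OF \<rho>2(1)]) auto
    then show "P x y \<le> \<rho>2 r" using \<rho>2(2)[of x y] by linarith
  qed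
  show "\<exists>r. \<forall>x y. P x y \<le> s \<longrightarrow> dist x y \<le> t \<longrightarrow> dist x0 x \<le> r" for s t
  proof (intro exI allI impI)
    fix x y assume "P x y \<le> s" "dist x y \<le> t"
    then have "\<rho>3 (P x y) (dist x y) \<le> \<rho>3 s t"
      using \<rho>3(1) nonneg[of x y] zero_le_dist[of x y] by blast
    then show "dist x0 x \<le> \<rho>3 s t" using \<rho>3(2)[of x y] by linarith
  qed
  show "\<exists>r. \<forall>x. dist x0 x > r \<longrightarrow> (\<exists>y. dist x0 y \<le> r \<and> P x y \<ge> s)" for s
  proof (rule exI, intro allI impI)
    fix x assume "dist x0 x > \<rho>4 (max s 0)"
    then obtain y where "dist x0 y \<le> \<rho>4 (max s 0)" "P x y \<ge> max s 0"
      using \<rho>4 max.cobounded2[of 0 s] by blast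
    then show "\<exists>y. dist x0 y \<le> \<rho>4 (max s 0) \<and> P x y \<ge> s" by auto
  qed
qed

section \<open>Sequences tending to infinity and the extended product\<close>

lemma gromov_seqs_iff:
  "xs \<in> gromov_seqs P \<longleftrightarrow> (\<forall>s. \<exists>N. \<forall>i\<ge>N. \<forall>j\<ge>N. P (xs i) (xs j) > s)"
proof -
  have "(\<exists>N. \<forall>i\<ge>N. \<forall>j\<ge>N. P (xs j) (xs i) > s) \<longleftrightarrow> (\<exists>N. \<forall>i\<ge>N. \<forall>j\<ge>N. P (xs i) (xs j) > s)" for s
    by blast
  then show ?thesis
    unfolding gromov_seqs_def mem_Collect_eq filterlim_at_top_dense eventually_prod_sequentially
    by simp
qed

lemma ext_product_Inl: "ext_product P (Inl x) (Inl y) = ereal (P x y)"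
  unfolding ext_product_def by (simp add: Liminf_const)

text \<open>The infimum runs over all representatives, so the bound is available for any pair of
  them that suits the argument; the tail on which it holds depends on the pair.\<close>

lemma ext_product_gtD:
  assumes "ext_product P p q > ereal s" "xs \<in> seqs_of p" "ys \<in> seqs_of q"
  shows "\<forall>\<^sub>F i in sequentially. P (xs i) (ys i) > s"
proof -
  have "ext_product P p q \<le> liminf (\<lambda>i. ereal (P (xs i) (ys i)))"
    unfolding ext_product_def using assms(2,3) by (intro INF_lower2[of "(xs, ys)"]) auto
  with assms(1) have "ereal s < liminf (\<lambda>i. ereal (P (xs i) (ys i)))" by (rule less_le_trans)
  from less_LiminfD[OF this] show ?thesis by simp
qed

text \<open>An eventual strict bound survives liminf and infimum only as a weak one, hence the gap
  between \<open>s\<close> and \<open>t\<close>; the uses take \<open>t = s + 1\<close>.\<close>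

lemma ext_product_gtI:
  assumes "\<And>xs ys. xs \<in> seqs_of p \<Longrightarrow> ys \<in> seqs_of q \<Longrightarrow>
      \<forall>\<^sub>F i in sequentially. P (xs i) (ys i) > t" and "s < t"
  shows "ext_product P p q > ereal s"
proof -
  have "ereal t \<le> ext_product P p q"
    unfolding ext_product_def
  proof (rule INF_greatest, clarify)
    fix xs ys assume "xs \<in> seqs_of p" "ys \<in> seqs_of q"
    then have "\<forall>\<^sub>F i in sequentially. P (xs i) (ys i) > t" by (rule assms(1))
    then show "ereal t \<le> liminf (\<lambda>i. ereal (P (xs i) (ys i)))"
      by (intro Liminf_bounded) (auto elim: eventually_mono)
  qed
  then show ?thesis using assms(2) by (meson ereal_less(1) less_ereal.simps(1) less_le_trans)
qed

context controlled
begin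

lemma ext_product_sym: "ext_product P p q = ext_product P q p"
proof -
  have *: "ext_product P p q \<le> ext_product P q p" for p q
    unfolding ext_product_def
  proof (rule INF_greatest, clarify)
    fix ys xs assume "ys \<in> seqs_of q" "xs \<in> seqs_of p"
    then show "(INF (xs, ys)\<in>seqs_of p \<times> seqs_of q. liminf (\<lambda>i. ereal (P (xs i) (ys i))))
        \<le> liminf (\<lambda>i. ereal (P (ys i) (xs i)))"
      by (intro INF_lower2[of "(xs, ys)"]) (auto simp: P_sym)
  qed
  show ?thesis by (rule order_antisym; rule *)
qed

text \<open>Reflexivity is the diagonal of the double limit, and transitivity is (CP1) applied term
  by term.\<close>

lemma equiv_gromov_rel: "equiv (gromov_seqs P) (gromov_rel P)"
proof (rule equivI)
  show "gromov_rel P \<subseteq> gromov_seqs P \<times> gromov_seqs P" unfolding gromov_rel_def by auto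
  show "refl_on (gromov_seqs P) (gromov_rel P)"
  proof (rule refl_onI)
    fix xs assume xs: "xs \<in> gromov_seqs P"
    then have "filterlim (\<lambda>i. P (xs i) (xs i)) at_top sequentially"
      unfolding gromov_seqs_iff filterlim_at_top_dense eventually_sequentially by blast
    then show "(xs, xs) \<in> gromov_rel P" using xs unfolding gromov_rel_def by simp
  qed
  show "sym (gromov_rel P)" by (rule symI) (simp add: gromov_rel_def P_sym)
  show "trans (gromov_rel P)"
  proof (rule transI)
    fix xs ys zs assume a: "(xs, ys) \<in> gromov_rel P" "(ys, zs) \<in> gromov_rel P"
    have "\<forall>\<^sub>F i in sequentially. P (xs i) (zs i) > s" for s
    proof -
      obtain m where m: "\<And>x y z. P x y > m \<Longrightarrow> P y z > m \<Longrightarrow> P x z > s" using cp1 by blast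
      have "\<forall>\<^sub>F i in sequentially. P (xs i) (ys i) > m" "\<forall>\<^sub>F i in sequentially. P (ys i) (zs i) > m"
        using a unfolding gromov_rel_def filterlim_at_top_dense by auto
      then show ?thesis by eventually_elim (rule m)
    qed
    then show "(xs, zs) \<in> gromov_rel P"
      using a unfolding gromov_rel_def filterlim_at_top_dense by auto
  qed
qed

lemma gromov_boundary_rel:
  assumes "c \<in> gromov_boundary P" "xs \<in> c" "ys \<in> c"
  shows "(xs, ys) \<in> gromov_rel P"
  using assms in_quotient_imp_in_rel[OF equiv_gromov_rel, of c xs ys]
  unfolding gromov_boundary_def by simp

lemma gromov_boundary_seqs:
  assumes "c \<in> gromov_boundary P" "xs \<in> c"
  shows "xs \<in> gromov_seqs P"
  using gromov_boundary_rel[OF assms assms(2)] unfolding gromov_rel_def by simp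

text \<open>Without representatives the infimum in \<open>ext_product\<close> would be \<infinity>
  for trivial reasons; arguments that pass through a point start by picking a sequence here.\<close>

lemma seqs_of_nonempty:
  assumes "p \<in> gromov_closure P"
  shows "seqs_of p \<noteq> {}"
  using assms in_quotient_imp_non_empty[OF equiv_gromov_rel]
  unfolding gromov_closure_def gromov_boundary_def by auto

section \<open>The entourages form a uniformity\<close>

lemma entourage_refl:
  assumes "p \<in> gromov_closure P" "n \<ge> 1"
  shows "(p, p) \<in> gromov_entourage P n"
proof (cases p)
  case (Inl x)
  \<comment> \<open>The metric part contains the diagonal of X only for \<open>n\<close> at least 1,
    since \<open>1 / real 0 = 0\<close>.\<close>
  then show ?thesis using assms(2) unfolding gromov_entourage_def by auto
next
  case (Inr c)
  with assms(1) have c: "c \<in> gromov_boundary P" unfolding gromov_closure_def by auto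
  have "ext_product P p p > ereal (real n)"
  proof (rule ext_product_gtI[where t="real n + 1"])
    fix xs ys assume "xs \<in> seqs_of p" "ys \<in> seqs_of p"
    then have "(xs, ys) \<in> gromov_rel P" using gromov_boundary_rel c Inr by simp
    then show "\<forall>\<^sub>F i in sequentially. P (xs i) (ys i) > real n + 1"
      unfolding gromov_rel_def filterlim_at_top_dense by simp
  qed simp
  then show ?thesis using assms(1) unfolding gromov_entourage_def by simp
qed

lemma entourage_sym: "(p, q) \<in> gromov_entourage P n \<Longrightarrow> (q, p) \<in> gromov_entourage P n"
  unfolding gromov_entourage_def using ext_product_sym[of p q] by (auto simp: dist_commute)

lemma entourage_InlI: "dist x y < 1 / real n \<Longrightarrow> (Inl x, Inl y) \<in> gromov_entourage P n"
  unfolding gromov_entourage_def by blast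

lemma entourage_closure:
  assumes "(p, q) \<in> gromov_entourage P n"
  shows "p \<in> gromov_closure P" "q \<in> gromov_closure P"
  using assms unfolding gromov_entourage_def gromov_closure_def by auto

lemma entourageE:
  assumes "(p, q) \<in> gromov_entourage P n"
  obtains "ext_product P p q > ereal (real n)"
    | x y where "p = Inl x" "q = Inl y" "dist x y < 1 / real n"
  using assms unfolding gromov_entourage_def by blast

text \<open>One sequence representing the middle point \<open>q\<close> is used in both products,
  and (CP1) is applied term by term along it.\<close>

lemma ext_product_trans:
  "\<exists>m. \<forall>p q r. q \<in> gromov_closure P \<longrightarrow> ext_product P p q > ereal m \<longrightarrow>
     ext_product P q r > ereal m \<longrightarrow> ext_product P p r > ereal s"
proof -
  obtain m where m: "\<And>x y z. P x y > m \<Longrightarrow> P y z > m \<Longrightarrow> P x z > s + 1" using cp1 by blast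
  show ?thesis
  proof (intro exI allI impI)
    fix p q r
    assume q: "q \<in> gromov_closure P" and pq: "ext_product P p q > ereal m"
      and qr: "ext_product P q r > ereal m"
    obtain ys where ys: "ys \<in> seqs_of q" using seqs_of_nonempty[OF q] by blast
    show "ext_product P p r > ereal s"
    proof (rule ext_product_gtI[where t="s + 1"])
      fix xs zs assume xs: "xs \<in> seqs_of p" and zs: "zs \<in> seqs_of r"
      show "\<forall>\<^sub>F i in sequentially. P (xs i) (zs i) > s + 1"
        using ext_product_gtD[OF pq xs ys] ext_product_gtD[OF qr ys zs]
        by eventually_elim (rule m)
    qed simp
  qed
qed

text \<open>A point \<open>y\<close> with a large product is far from the base point by (CP2), and then (CP3) makes
  its product with every nearby point large.\<close>

lemma product_near:
  "\<exists>m. \<forall>x y z. P x y > m \<longrightarrow> dist y z \<le> 1 \<longrightarrow> P y z > s"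
proof -
  obtain r where r: "\<And>x y. P x y \<le> s \<Longrightarrow> dist x y \<le> 1 \<Longrightarrow> dist x0 x \<le> r" using cp3 by blast
  obtain M where M: "\<And>x y. dist x0 x \<le> r \<Longrightarrow> P x y \<le> M" using cp2 by blast
  show ?thesis
  proof (intro exI allI impI)
    fix x y z assume xy: "P x y > M" and yz: "dist y z \<le> 1"
    show "P y z > s"
    proof (rule ccontr)
      assume "\<not> P y z > s"
      then have "dist x0 y \<le> r" using r[of y z] yz by simp
      then show False using M[of y x] xy P_sym[of x y] by simp
    qed
  qed
qed

text \<open>A single term of a sequence representing \<open>p\<close> witnesses that
  \<open>y\<close> is far out, as \<open>product_near\<close> requires; then \<open>Inl y\<close> is
  the middle point in \<open>ext_product_trans\<close>. This settles the composition of the two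
  kinds of nearness.\<close>

lemma ext_product_near:
  "\<exists>m. \<forall>p y z. p \<in> gromov_closure P \<longrightarrow> ext_product P p (Inl y) > ereal m \<longrightarrow> dist y z \<le> 1 \<longrightarrow>
     ext_product P p (Inl z) > ereal s"
proof -
  obtain m where m: "\<And>p q r. q \<in> gromov_closure P \<Longrightarrow> ext_product P p q > ereal m \<Longrightarrow>
     ext_product P q r > ereal m \<Longrightarrow> ext_product P p r > ereal s"
    using ext_product_trans by blast
  obtain m' where m': "\<And>x y z. P x y > m' \<Longrightarrow> dist y z \<le> 1 \<Longrightarrow> P y z > m"
    using product_near by blast
  show ?thesis
  proof (intro exI allI impI)
    fix p y z
    assume p: "p \<in> gromov_closure P" and py: "ext_product P p (Inl y) > ereal (max m m')"
      and yz: "dist y z \<le> 1"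
    obtain xs where xs: "xs \<in> seqs_of p" using seqs_of_nonempty[OF p] by blast
    have "\<forall>\<^sub>F i in sequentially. P (xs i) y > max m m'"
      using ext_product_gtD[OF py xs, of "\<lambda>i. y"] by simp
    then obtain i where "P (xs i) y > max m m'"
      using eventually_happens trivial_limit_sequentially by blast
    then have "P y z > m" using m'[of "xs i" y z] yz by simp
    moreover have "ext_product P p (Inl y) > ereal m"
      using py by (meson ereal_less_eq(3) le_less_trans max.cobounded1)
    moreover have "Inl y \<in> gromov_closure P" unfolding gromov_closure_def by simp
    ultimately show "ext_product P p (Inl z) > ereal s"
      by (intro m[of "Inl y"]) (auto simp: ext_product_Inl)
  qed
qed

lemma entourage_comp:
  assumes "n \<ge> 1"
  shows "\<exists>m\<ge>1. \<forall>p q r. (p, q) \<in> gromov_entourage P m \<longrightarrow> (q, r) \<in> gromov_entourage P m \<longrightarrow>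
    (p, r) \<in> gromov_entourage P n"
proof -
  obtain s where s: "\<And>p q r. q \<in> gromov_closure P \<Longrightarrow> ext_product P p q > ereal s \<Longrightarrow>
     ext_product P q r > ereal s \<Longrightarrow> ext_product P p r > ereal (real n)"
    using ext_product_trans by blast
  obtain t where t: "\<And>p y z. p \<in> gromov_closure P \<Longrightarrow> ext_product P p (Inl y) > ereal t \<Longrightarrow>
     dist y z \<le> 1 \<Longrightarrow> ext_product P p (Inl z) > ereal (real n)"
    using ext_product_near by blast
  obtain k :: nat where k: "max s t \<le> real k" using real_arch_simple by blast
  \<comment> \<open>The bound \<open>k\<close> serves the three cases that involve a large product;
    \<open>2 * n\<close> lets two metric steps add up to less than
    \<open>1 / real n\<close>.\<close>
  define m where "m = max k (2 * n)"
  have m1: "m \<ge> 1" and ms: "s \<le> real m" and mt: "t \<le> real m" and mn: "m \<ge> 2 * n"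
    unfolding m_def using k assms by linarith+
  have m_small: "1 / real m \<le> (1 / real n) / 2"
    using mn assms by (simp add: field_simps)
  have m_le1: "1 / real m \<le> 1" using m1 by simp
  have es: "ext_product P p q > ereal s" if "ext_product P p q > ereal (real m)" for p q
    using that ms by (meson ereal_less_eq(3) le_less_trans)
  have et: "ext_product P p q > ereal t" if "ext_product P p q > ereal (real m)" for p q
    using that mt by (meson ereal_less_eq(3) le_less_trans)
  have "(p, r) \<in> gromov_entourage P n"
    if pq: "(p, q) \<in> gromov_entourage P m" and qr: "(q, r) \<in> gromov_entourage P m" for p q r
  proof -
    have "ext_product P p r > ereal (real n) \<or>
        (\<exists>x y. p = Inl x \<and> r = Inl y \<and> dist x y < 1 / real n)"
    proof (rule entourageE[OF pq]; rule entourageE[OF qr])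
      assume a: "ext_product P p q > ereal (real m)" "ext_product P q r > ereal (real m)"
      show ?thesis by (rule disjI1, rule s[OF entourage_closure(1)[OF qr] es[OF a(1)] es[OF a(2)]])
    next
      fix y z
      assume a: "ext_product P p q > ereal (real m)" "q = Inl y" "r = Inl z" "dist y z < 1 / real m"
      have "dist y z \<le> 1" using a(4) m_le1 by linarith
      then have "ext_product P p (Inl z) > ereal (real n)"
        using a(2) by (intro t[OF entourage_closure(1)[OF pq] _]) (use et[OF a(1)] in simp)
      then show ?thesis using a(3) by simp
    next
      fix x y
      assume a: "p = Inl x" "q = Inl y" "dist x y < 1 / real m" "ext_product P q r > ereal (real m)"
      have "dist y x \<le> 1" using a(3) m_le1 dist_commute[of x y] by linarith
      then have "ext_product P r (Inl x) > ereal (real n)"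
        using a(2) by (intro t[OF entourage_closure(2)[OF qr] _])
          (use et[OF a(4)] ext_product_sym[of q r] in simp)
      then show ?thesis using a(1) ext_product_sym[of p r] by simp
    next
      fix x y y' z assume "p = Inl x" "q = Inl y" "dist x y < 1 / real m"
        "q = Inl y'" "r = Inl z" "dist y' z < 1 / real m"
      then show ?thesis using dist_triangle[of x z y] m_small by auto
    qed
    then show ?thesis
      using entourage_closure(1)[OF pq] entourage_closure(2)[OF qr]
      unfolding gromov_entourage_def by blast
  qed
  with m1 show ?thesis by blast
qed

section \<open>Separation of points and density of X\<close>

lemma ext_product_Inl_bounded:
  "\<exists>M. \<forall>y q. dist x0 y \<le> r \<longrightarrow> q \<in> gromov_closure P \<longrightarrow> \<not> ext_product P (Inl y) q > ereal M"
proof -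
  obtain M where M: "\<And>x y. dist x0 x \<le> r \<Longrightarrow> P x y \<le> M" using cp2 by blast
  have "\<not> ext_product P (Inl y) q > ereal M" if y: "dist x0 y \<le> r" and q: "q \<in> gromov_closure P" for y q
  proof
    assume a: "ext_product P (Inl y) q > ereal M"
    obtain ys where ys: "ys \<in> seqs_of q" using seqs_of_nonempty[OF q] by blast
    have "\<forall>\<^sub>F i in sequentially. P y (ys i) > M"
      using ext_product_gtD[OF a _ ys, of "\<lambda>i. y"] by simp
    then obtain i where "P y (ys i) > M"
      using eventually_happens trivial_limit_sequentially by blast
    then show False using M[OF y, of "ys i"] by simp
  qed
  then show ?thesis by blast
qed

text \<open>By (CP2) all products with the fixed point \<open>x\<close> are bounded, so for large
  \<open>n\<close> only the metric part of the entourage remains. This keeps the boundary away from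
  \<open>x\<close>, and it will show that X is open and carries its original topology.\<close>

lemma entourage_Inl:
  assumes "e > 0"
  shows "\<exists>n\<ge>1. \<forall>q. (Inl x, q) \<in> gromov_entourage P n \<longrightarrow> (\<exists>y. q = Inl y \<and> dist x y < e)"
proof -
  obtain M where M: "\<And>q. q \<in> gromov_closure P \<Longrightarrow> \<not> ext_product P (Inl x) q > ereal M"
    using ext_product_Inl_bounded[of "dist x0 x"] by blast
  obtain k :: nat where k: "max M (1 / e) \<le> real k" using real_arch_simple by blast
  define n where "n = Suc k"
  have n: "M \<le> real n" "1 / e < real n" using k unfolding n_def by auto
  have ne: "1 / real n < e" using n(2) assms by (simp add: field_simps n_def)
  have "\<exists>y. q = Inl y \<and> dist x y < e" if q: "(Inl x, q) \<in> gromov_entourage P n" for q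
    using q
  proof (rule entourageE)
    assume "ext_product P (Inl x) q > ereal (real n)"
    then have "ext_product P (Inl x) q > ereal M" using n(1) by (meson ereal_less_eq(3) le_less_trans)
    then show ?thesis using M[OF entourage_closure(2)[OF q]] by blast
  next
    fix x' y assume "Inl x = (Inl x' :: 'a gromov_point)" "q = Inl y" "dist x' y < 1 / real n"
    then show ?thesis using ne by auto
  qed
  then show ?thesis unfolding n_def by (intro exI[of _ "Suc k"]) auto
qed

text \<open>Near a point of X the claim reduces to the metric by \<open>entourage_Inl\<close>. For
  two boundary points any representatives have products tending to infinity, which is exactly the
  equivalence defining the boundary.\<close>

lemma entourage_separated:
  assumes "\<And>n. n \<ge> 1 \<Longrightarrow> (p, q) \<in> gromov_entourage P n"
  shows "p = q"
proof (cases p)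
  case (Inl x)
  have *: "\<exists>y. q = Inl y \<and> dist x y < e" if "e > 0" for e
    using entourage_Inl[OF that, of x] assms Inl by blast
  obtain y where y: "q = Inl y" using *[of 1] by auto
  have "dist x y < e" if "e > 0" for e using *[OF that] y by auto
  then have "x = y" by (metis dist_eq_0_iff less_irrefl zero_less_dist_iff)
  then show ?thesis using Inl y by simp
next
  case (Inr c)
  show ?thesis
  proof (cases q)
    case (Inl x)
    have "\<exists>n\<ge>1. \<forall>q. (Inl x, q) \<in> gromov_entourage P n \<longrightarrow> (\<exists>y. q = Inl y \<and> dist x y < 1)"
      by (rule entourage_Inl) simp
    then show ?thesis using entourage_sym assms Inl Inr by blast
  next
    case (Inr c')
    have c: "c \<in> gromov_boundary P" "c' \<in> gromov_boundary P"
      using entourage_closure[OF assms[of 1]] \<open>p = Inr c\<close> Inr unfolding gromov_closure_def by auto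
    obtain xs ys where xs: "xs \<in> c" and ys: "ys \<in> c'"
      using entourage_closure[OF assms[of 1], THEN seqs_of_nonempty] \<open>p = Inr c\<close> Inr by auto
    have "\<forall>\<^sub>F i in sequentially. P (xs i) (ys i) > s" for s
    proof -
      obtain k :: nat where k: "s \<le> real k" using real_arch_simple by blast
      have "ext_product P p q > ereal (real (Suc k))"
        by (rule entourageE[OF assms[of "Suc k"]]) (use \<open>p = Inr c\<close> in auto)
      then have "\<forall>\<^sub>F i in sequentially. P (xs i) (ys i) > real (Suc k)"
        by (rule ext_product_gtD) (use xs ys \<open>p = Inr c\<close> Inr in auto)
      then show ?thesis by eventually_elim (use k in auto)
    qed
    then have "(xs, ys) \<in> gromov_rel P"
      using c xs ys gromov_boundary_seqs unfolding gromov_rel_def filterlim_at_top_dense by auto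
    then have "c = c'"
      using quotient_eqI[OF equiv_gromov_rel] c xs ys unfolding gromov_boundary_def by blast
    then show ?thesis using \<open>p = Inr c\<close> Inr by simp
  qed
qed

text \<open>To compare \<open>xs i\<close> with another representative \<open>ys\<close>, the term
  \<open>xs j\<close> is inserted in (CP1): the double limit controls its product with
  \<open>xs i\<close>, the equivalence its product with \<open>ys j\<close>. Thus a sequence
  converges to its own class.\<close>

lemma entourage_seq:
  assumes c: "c \<in> gromov_boundary P" and xs: "xs \<in> c"
  shows "\<forall>\<^sub>F i in sequentially. (Inl (xs i), Inr c) \<in> gromov_entourage P n"
proof -
  obtain m where m: "\<And>x y z. P x y > m \<Longrightarrow> P y z > m \<Longrightarrow> P x z > real n + 1" using cp1 by blast
  obtain N where N: "\<And>i j. i \<ge> N \<Longrightarrow> j \<ge> N \<Longrightarrow> P (xs i) (xs j) > m"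
    using gromov_boundary_seqs[OF assms] unfolding gromov_seqs_iff by blast
  have "(Inl (xs i), Inr c) \<in> gromov_entourage P n" if i: "i \<ge> N" for i
  proof -
    have "ext_product P (Inl (xs i)) (Inr c) > ereal (real n)"
    proof (rule ext_product_gtI[where t="real n + 1"])
      fix us ys assume "us \<in> seqs_of (Inl (xs i))" "ys \<in> seqs_of (Inr c)"
      then have us: "us = (\<lambda>j. xs i)" and ys: "ys \<in> c" by auto
      have "\<forall>\<^sub>F j in sequentially. P (xs j) (ys j) > m"
        using gromov_boundary_rel[OF c xs ys] unfolding gromov_rel_def filterlim_at_top_dense by simp
      moreover have "\<forall>\<^sub>F j in sequentially. P (xs i) (xs j) > m"
        using N[OF i] unfolding eventually_sequentially by blast
      ultimately show "\<forall>\<^sub>F j in sequentially. P (us j) (ys j) > real n + 1"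
        unfolding us by eventually_elim (rule m)
    qed simp
    moreover have "Inl (xs i) \<in> gromov_closure P" "Inr c \<in> gromov_closure P"
      using c unfolding gromov_closure_def by auto
    ultimately show ?thesis unfolding gromov_entourage_def by simp
  qed
  then show ?thesis unfolding eventually_sequentially by blast
qed

lemma entourage_dense:
  assumes "p \<in> gromov_closure P" "n \<ge> 1"
  shows "\<exists>x. (Inl x, p) \<in> gromov_entourage P n"
proof (cases p)
  case (Inl x)
  then show ?thesis using entourage_refl[OF assms] by auto
next
  case (Inr c)
  then have c: "c \<in> gromov_boundary P" using assms unfolding gromov_closure_def by auto
  obtain xs where "xs \<in> c" using seqs_of_nonempty[OF assms(1)] Inr by auto
  from eventually_happens[OF entourage_seq[OF c this, of n]] show ?thesis
    using Inr by auto
qed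

end

section \<open>The Gromov compactification as a compact metric space\<close>

text \<open>Replacing each term by a point of \<open>S\<close> within
  \<open>1 / real (Suc i)\<close> changes neither the Cauchy property nor the limit. It reduces
  completeness to sequences in X, where bounded and unbounded behaviour can be told apart.\<close>

lemma (in Metric_space) mcomplete_if_dense:
  assumes S: "S \<subseteq> M" and dense: "mtopology closure_of S = M"
    and lim: "\<And>\<sigma>. MCauchy \<sigma> \<Longrightarrow> range \<sigma> \<subseteq> S \<Longrightarrow> \<exists>a. limitin mtopology \<sigma> a sequentially"
  shows mcomplete
  unfolding mcomplete_def
proof (intro allI impI)
  fix \<sigma> assume \<sigma>: "MCauchy \<sigma>"
  then have \<sigma>M: "\<sigma> i \<in> M" for i unfolding MCauchy_def by auto
  have "\<exists>y\<in>S. d (\<sigma> i) y < 1 / real (Suc i)" for i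
  proof -
    have "\<sigma> i \<in> mtopology closure_of S" using \<sigma>M dense by simp
    moreover have "(0::real) < 1 / real (Suc i)" by simp
    ultimately show ?thesis unfolding metric_closure_of in_mball by blast
  qed
  then obtain \<tau> where \<tau>: "\<And>i. \<tau> i \<in> S" "\<And>i. d (\<sigma> i) (\<tau> i) < 1 / real (Suc i)" by metis
  then have \<tau>M: "\<tau> i \<in> M" for i using S by blast
  have close: "\<exists>N. \<forall>i\<ge>N. d (\<sigma> i) (\<tau> i) < e" if e: "e > 0" for e
  proof -
    obtain N where N: "1 / real (Suc N) < e" using nat_approx_posE[OF e] by blast
    have "d (\<sigma> i) (\<tau> i) < e" if "i \<ge> N" for i
    proof -
      have "1 / real (Suc i) \<le> 1 / real (Suc N)" using that by (intro frac_le) auto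
      then show ?thesis using \<tau>(2)[of i] N by linarith
    qed
    then show ?thesis by blast
  qed
  have "MCauchy \<tau>"
    unfolding MCauchy_def
  proof (intro conjI allI impI)
    show "range \<tau> \<subseteq> M" using \<tau>M by blast
    fix e :: real assume "e > 0"
    then obtain N1 where N1: "\<And>i. i \<ge> N1 \<Longrightarrow> d (\<sigma> i) (\<tau> i) < e / 3"
      using close[of "e / 3"] by auto
    obtain N2 where N2: "\<And>i j. i \<ge> N2 \<Longrightarrow> j \<ge> N2 \<Longrightarrow> d (\<sigma> i) (\<sigma> j) < e / 3"
      using \<sigma> \<open>e > 0\<close> unfolding MCauchy_def by (meson divide_pos_pos zero_less_numeral)
    have "d (\<tau> i) (\<tau> j) < e" if "i \<ge> max N1 N2" "j \<ge> max N1 N2" for i j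
    proof -
      have "d (\<tau> i) (\<tau> j) \<le> d (\<tau> i) (\<sigma> i) + d (\<sigma> i) (\<tau> j)" using \<tau>M \<sigma>M by (intro triangle)
      moreover have "d (\<sigma> i) (\<tau> j) \<le> d (\<sigma> i) (\<sigma> j) + d (\<sigma> j) (\<tau> j)" using \<tau>M \<sigma>M by (intro triangle)
      moreover have "d (\<tau> i) (\<sigma> i) < e / 3" using N1[of i] that commute[of "\<tau> i"] by simp
      moreover have "d (\<sigma> j) (\<tau> j) < e / 3" "d (\<sigma> i) (\<sigma> j) < e / 3" using N1[of j] N2[of i j] that by auto
      ultimately show ?thesis by linarith
    qed
    then show "\<exists>N. \<forall>n n'. N \<le> n \<longrightarrow> N \<le> n' \<longrightarrow> d (\<tau> n) (\<tau> n') < e" by blast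
  qed
  then obtain a where a: "limitin mtopology \<tau> a sequentially" using lim \<tau>(1) by blast
  have "limitin mtopology \<sigma> a sequentially"
    unfolding limitin_metric
  proof (intro conjI allI impI)
    show aM: "a \<in> M" using a by (rule limitin_mspace)
    fix e :: real assume "e > 0"
    then have "\<forall>\<^sub>F i in sequentially. \<tau> i \<in> M \<and> d (\<tau> i) a < e / 2"
      using a unfolding limitin_metric by (meson half_gt_zero)
    moreover have "\<forall>\<^sub>F i in sequentially. d (\<sigma> i) (\<tau> i) < e / 2"
      using close[of "e / 2"] \<open>e > 0\<close> unfolding eventually_sequentially by simp
    ultimately show "\<forall>\<^sub>F i in sequentially. \<sigma> i \<in> M \<and> d (\<sigma> i) a < e"
    proof eventually_elim
      case (elim i)
      then show ?case using triangle[OF \<sigma>M[of i] \<tau>M[of i] aM] \<sigma>M by auto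
    qed
  qed
  then show "\<exists>a. limitin mtopology \<sigma> a sequentially" ..
qed

text \<open>The metric enters only through its bound and its two comparisons with the entourages.
  \<open>d_small\<close> is confined to the closure because the constructed metric vanishes on the
  diagonal of the whole sum type, whose junk points lie in no entourage.\<close>

locale gromov_metric = controlled x0 P + Metric_space "gromov_closure P" d
  for x0 :: "'a::metric_space" and P and d +
  assumes d_le_1: "d p q \<le> 1"
    and d_small: "n \<ge> 1 \<Longrightarrow> \<exists>e>0. \<forall>p\<in>gromov_closure P. \<forall>q\<in>gromov_closure P.
        d p q < e \<longrightarrow> (p, q) \<in> gromov_entourage P n"
    and entourage_small: "e > 0 \<Longrightarrow> \<exists>n\<ge>1. \<forall>p q. (p, q) \<in> gromov_entourage P n \<longrightarrow> d p q < e"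

lemma (in controlled) ex_gromov_metric: "\<exists>d. gromov_metric x0 P d"
proof -
  \<comment> \<open>\<open>Id\<close> gives reflexivity at junk points outside the closure;
    \<open>Suc\<close> skips the index 0, where reflexivity can fail even on X.\<close>
  define V where "V n = gromov_entourage P (Suc n) \<union> Id" for n
  have refl: "Id \<subseteq> V n" for n unfolding V_def by blast
  have sym: "sym (V n)" for n
    unfolding V_def by (rule symI) (auto dest: entourage_sym)
  have anti: "V n \<subseteq> V m" if "m \<le> n" for m n
  proof
    fix z assume "z \<in> V n"
    moreover have "(p, q) \<in> gromov_entourage P (Suc m)" if "(p, q) \<in> gromov_entourage P (Suc n)" for p q
      by (rule gromov_entourage_antimono[OF _ _ that]) (use \<open>m \<le> n\<close> in auto)
    ultimately show "z \<in> V m" unfolding V_def by (cases z) auto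
  qed
  have comp: "\<exists>m. V m O V m \<subseteq> V n" for n
  proof -
    obtain m where m: "m \<ge> 1" "\<And>p q r. (p, q) \<in> gromov_entourage P m \<Longrightarrow>
        (q, r) \<in> gromov_entourage P m \<Longrightarrow> (p, r) \<in> gromov_entourage P (Suc n)"
      using entourage_comp[of "Suc n"] by auto
    obtain k where k: "m = Suc k" using m(1) by (cases m) auto
    have sub: "(p, q) \<in> gromov_entourage P (Suc n)" if pq: "(p, q) \<in> gromov_entourage P m" for p q
      using m(2)[OF pq entourage_refl[OF entourage_closure(2)[OF pq] m(1)]] .
    have "V k O V k \<subseteq> V n"
    proof (rule subsetI, elim relcompE)
      fix z p q r assume z: "z = (p, r)" "(p, q) \<in> V k" "(q, r) \<in> V k"
      then show "z \<in> V n" using m(2)[of p q r] sub[of p r] unfolding V_def k by auto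
    qed
    then show ?thesis ..
  qed
  show ?thesis
  proof (rule countable_uniformity_pseudometric[OF refl sym anti comp])
    fix d :: "'a gromov_point \<Rightarrow> 'a gromov_point \<Rightarrow> real"
    assume d: "\<And>p q. 0 \<le> d p q" "\<And>p q. d p q = d q p" "\<And>p. d p p = 0"
      "\<And>p q r. d p r \<le> d p q + d q r" "\<And>p q. d p q \<le> 1"
      "\<And>n. \<exists>e>0. \<forall>p q. d p q < e \<longrightarrow> (p, q) \<in> V n"
      "\<And>e. e > 0 \<Longrightarrow> \<exists>n. \<forall>p q. (p, q) \<in> V n \<longrightarrow> d p q < e"
    have small: "\<exists>e>0. \<forall>p\<in>gromov_closure P. \<forall>q\<in>gromov_closure P.
        d p q < e \<longrightarrow> (p, q) \<in> gromov_entourage P n" if n: "n \<ge> 1" for n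
    proof -
      obtain k where k: "n = Suc k" using n by (cases n) auto
      obtain e where e: "e > 0" "\<And>p q. d p q < e \<Longrightarrow> (p, q) \<in> V k" using d(6)[of k] by auto
      have "(p, q) \<in> gromov_entourage P n" if "p \<in> gromov_closure P" "d p q < e" for p q
        using e(2)[OF that(2)] entourage_refl[OF that(1) n] unfolding V_def k by auto
      then show ?thesis using e(1) by blast
    qed
    have eq: "p = q" if p: "p \<in> gromov_closure P" and q: "q \<in> gromov_closure P" and "d p q = 0" for p q
      by (rule entourage_separated) (use small p q \<open>d p q = 0\<close> in fastforce)
    have "gromov_metric x0 P d"
    proof
      show "d p q = 0 \<longleftrightarrow> p = q" if "p \<in> gromov_closure P" "q \<in> gromov_closure P" for p q
        using eq[OF that] d(3) by blast
      show "d p r \<le> d p q + d q r" for p q r by (rule d(4))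
      show "\<exists>e>0. \<forall>p\<in>gromov_closure P. \<forall>q\<in>gromov_closure P.
        d p q < e \<longrightarrow> (p, q) \<in> gromov_entourage P n" if n: "n \<ge> 1" for n by (rule small[OF that])
      show "\<exists>n\<ge>1. \<forall>p q. (p, q) \<in> gromov_entourage P n \<longrightarrow> d p q < e" if e: "e > 0" for e
      proof -
        obtain n where "\<And>p q. (p, q) \<in> V n \<Longrightarrow> d p q < e" using d(7)[OF e] by blast
        then show ?thesis unfolding V_def by (intro exI[of _ "Suc n"]) auto
      qed
    qed (use d in auto)
    then show ?thesis by blast
  qed
qed

context gromov_metric
begin

section \<open>The metric topology and the embedding of X\<close>

lemma Inl_closure: "Inl x \<in> gromov_closure P"
  unfolding gromov_closure_def by blast

lemma mtopology_eq_gromov_topology: "mtopology = gromov_topology P"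
  unfolding topology_eq openin_mtopology openin_gromov_topology
proof (intro allI conj_cong refl iffI ballI allI impI)
  fix U p
  assume U: "U \<subseteq> gromov_closure P" and p: "p \<in> U"
  {
    assume "\<forall>p. p \<in> U \<longrightarrow> (\<exists>r>0. mball p r \<subseteq> U)"
    then obtain r where r: "r > 0" "mball p r \<subseteq> U" using p by blast
    obtain n where n: "n \<ge> 1" "\<And>p q. (p, q) \<in> gromov_entourage P n \<Longrightarrow> d p q < r"
      using entourage_small[OF r(1)] by blast
    have "{q. (q, p) \<in> gromov_entourage P n} \<subseteq> mball p r"
    proof
      fix q assume "q \<in> {q. (q, p) \<in> gromov_entourage P n}"
      then have "(q, p) \<in> gromov_entourage P n" by simp
      then show "q \<in> mball p r" using n(2)[of q p] entourage_closure[of q p n] commute[of p q] by auto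
    qed
    then show "\<exists>n\<ge>1. {q. (q, p) \<in> gromov_entourage P n} \<subseteq> U" using n(1) r(2) by blast
  next
    assume "\<forall>p\<in>U. \<exists>n\<ge>1. {q. (q, p) \<in> gromov_entourage P n} \<subseteq> U"
    then obtain n where n: "n \<ge> 1" "{q. (q, p) \<in> gromov_entourage P n} \<subseteq> U" using p by blast
    obtain e where e: "e > 0" "\<forall>p\<in>gromov_closure P. \<forall>q\<in>gromov_closure P.
        d p q < e \<longrightarrow> (p, q) \<in> gromov_entourage P n" using d_small[OF n(1)] by blast
    have "mball p e \<subseteq> U"
    proof
      fix q assume "q \<in> mball p e"
      then have "(q, p) \<in> gromov_entourage P n" using e(2) commute[of p q] by auto
      then show "q \<in> U" using n(2) by blast
    qed
    then show "\<exists>r>0. mball p r \<subseteq> U" using e(1) by blast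
  }
qed

text \<open>The metric part of the entourages makes \<open>Inl\<close> uniformly continuous; this
  serves both the embedding and the continuity of the distance functions.\<close>

lemma d_Inl_near:
  assumes "e > 0"
  shows "\<exists>r>0. \<forall>x y. dist x y < r \<longrightarrow> d (Inl x) (Inl y) < e"
proof -
  obtain n where n: "n \<ge> 1" "\<And>p q. (p, q) \<in> gromov_entourage P n \<Longrightarrow> d p q < e"
    using entourage_small[OF assms] by blast
  then show ?thesis by (intro exI[of _ "1 / real n"]) (auto intro: entourage_InlI)
qed

lemma continuous_map_Inl: "continuous_map euclidean mtopology Inl"
  unfolding continuous_map_to_metric
proof (intro ballI allI impI)
  fix x :: 'a and e :: real assume "e > 0"
  then obtain r where r: "r > 0" "\<And>x y. dist x y < r \<Longrightarrow> d (Inl x) (Inl y) < e"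
    using d_Inl_near by metis
  show "\<exists>U. openin euclidean U \<and> x \<in> U \<and> (\<forall>y\<in>U. Inl y \<in> mball (Inl x) e)"
    using r Inl_closure by (intro exI[of _ "ball x r"]) auto
qed

text \<open>A small \<open>d\<close>-ball around a point of X contains no boundary point, by
  \<open>entourage_Inl\<close>; so images are open in the whole compactification and not merely in
  the range.\<close>

lemma open_map_Inl: "open_map euclidean mtopology Inl"
  unfolding open_map_def
proof (intro allI impI)
  fix U :: "'a set" assume "openin euclidean U"
  then have U: "open U" by simp
  show "openin mtopology (Inl ` U)"
    unfolding openin_mtopology
  proof (intro conjI allI impI)
    show "Inl ` U \<subseteq> gromov_closure P" using Inl_closure by blast
    fix p :: "'a gromov_point" assume "p \<in> Inl ` U"
    then obtain x where p: "p = Inl x" and x: "x \<in> U" by blast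
    obtain e where e: "e > 0" "ball x e \<subseteq> U" using U x openE by blast
    obtain n where n: "n \<ge> 1"
        "\<And>q. (Inl x, q) \<in> gromov_entourage P n \<Longrightarrow> \<exists>y. q = Inl y \<and> dist x y < e"
      using entourage_Inl[OF e(1)] by blast
    obtain r where r: "r > 0" "\<forall>p\<in>gromov_closure P. \<forall>q\<in>gromov_closure P.
        d p q < r \<longrightarrow> (p, q) \<in> gromov_entourage P n" using d_small[OF n(1)] by blast
    have "mball p r \<subseteq> Inl ` U"
    proof
      fix q assume "q \<in> mball p r"
      then have "(Inl x, q) \<in> gromov_entourage P n" using r(2) unfolding p by auto
      then obtain y where "q = Inl y" "dist x y < e" using n(2) by blast
      then show "q \<in> Inl ` U" using e(2) by auto
    qed
    then show "\<exists>r>0. mball p r \<subseteq> Inl ` U" using r(1) by blast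
  qed
qed

lemma embedding_map_Inl: "embedding_map euclidean mtopology Inl"
  by (rule injective_open_imp_embedding_map[OF continuous_map_Inl open_map_Inl]) simp

lemma closure_of_range_Inl: "mtopology closure_of (range Inl) = gromov_closure P"
proof -
  have "\<exists>y\<in>range Inl. y \<in> mball p r" if p: "p \<in> gromov_closure P" and "r > 0" for p r
  proof -
    obtain n where n: "n \<ge> 1" "\<And>p q. (p, q) \<in> gromov_entourage P n \<Longrightarrow> d p q < r"
      using entourage_small[OF \<open>r > 0\<close>] by blast
    obtain x where "(Inl x, p) \<in> gromov_entourage P n" using entourage_dense[OF p n(1)] by blast
    then have "d p (Inl x) < r" using n(2) commute by metis
    then show ?thesis using p Inl_closure by auto
  qed
  then show ?thesis unfolding metric_closure_of by blast
qed

text \<open>By (CP4), a point far from the base point has a large product with some point \<open>y\<close> of a fixed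
  ball, hence also with a nearby point of a finite net of that ball.\<close>

lemma mtotally_bounded_range_Inl:
  assumes proper: "\<And>S :: 'a set. closed S \<Longrightarrow> bounded S \<Longrightarrow> compact S"
  shows "mtotally_bounded (range Inl)"
  unfolding mtotally_bounded_def
proof (intro allI impI)
  fix e :: real assume "e > 0"
  then obtain n where n: "n \<ge> 1" "\<And>p q. (p, q) \<in> gromov_entourage P n \<Longrightarrow> d p q < e"
    using entourage_small by blast
  obtain s where s: "\<And>x y z. P x y > s \<Longrightarrow> P y z > s \<Longrightarrow> P x z > real n" using cp1 by blast
  obtain t where t: "\<And>x y z. P x y > t \<Longrightarrow> dist y z \<le> 1 \<Longrightarrow> P y z > s" using product_near by blast
  \<comment> \<open>The same product has to trigger \<open>product_near\<close> through
    \<open>t\<close> and (CP1) through \<open>s\<close>; the \<open>+ 1\<close> turns the weak bound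
    into strict ones.\<close>
  obtain r where r: "\<And>x. dist x0 x > r \<Longrightarrow> \<exists>y. dist x0 y \<le> r \<and> P x y \<ge> max s t + 1"
    using cp4 by blast
  have "compact (cball x0 r)" by (rule proper) auto
  moreover have "0 < 1 / real n" using n(1) by simp
  ultimately obtain A where A: "finite A" "cball x0 r \<subseteq> (\<Union>a\<in>A. ball a (1 / real n))"
    unfolding compact_eq_totally_bounded by blast
  \<comment> \<open>The net radius has two roles: it yields metric entourages inside the ball, and
    it stays within the distance 1 allowed by \<open>product_near\<close>.\<close>
  have n_le1: "1 / real n \<le> 1" using n(1) by simp
  have "\<exists>a\<in>A. (Inl a, Inl x) \<in> gromov_entourage P n" for x
  proof (cases "dist x0 x \<le> r")
    case True
    then obtain a where "a \<in> A" "dist a x < 1 / real n" using A(2) by auto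
    then show ?thesis by (blast intro: entourage_InlI)
  next
    case False
    then obtain y where y: "dist x0 y \<le> r" "P x y \<ge> max s t + 1" using r[of x] by auto
    then obtain a where a: "a \<in> A" "dist a y < 1 / real n" using A(2) by auto
    have xy: "P x y > t" "P x y > s" using y(2) by auto
    have "dist y a \<le> 1" using a(2) n_le1 dist_commute[of a y] by linarith
    then have "P x a > real n" using s[OF xy(2) t[OF xy(1)]] by blast
    then have "(Inl a, Inl x) \<in> gromov_entourage P n"
      unfolding gromov_entourage_def using Inl_closure P_sym[of x a] by (auto simp: ext_product_Inl)
    then show ?thesis using a(1) by blast
  qed
  then have "range Inl \<subseteq> (\<Union>p\<in>Inl ` A. mball p e)"
    using n(2) Inl_closure by fastforce
  then show "\<exists>K. finite K \<and> K \<subseteq> range Inl \<and> range Inl \<subseteq> (\<Union>x\<in>K. mball x e)"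
    using A(1) by (intro exI[of _ "Inl ` A"]) auto
qed

lemma mcomplete_mtopology:
  assumes proper: "\<And>S :: 'a set. closed S \<Longrightarrow> bounded S \<Longrightarrow> compact S"
  shows mcomplete
proof (rule mcomplete_if_dense[OF _ closure_of_range_Inl])
  show "range Inl \<subseteq> gromov_closure P" using Inl_closure by blast
  fix \<sigma> assume \<sigma>: "MCauchy \<sigma>" and "range \<sigma> \<subseteq> range Inl"
  then have "\<forall>i. \<exists>x. \<sigma> i = Inl x" by blast
  then obtain xs where xs: "\<And>i. \<sigma> i = Inl (xs i)" by metis
  show "\<exists>a. limitin mtopology \<sigma> a sequentially"
  proof (cases "\<exists>r. \<forall>N. \<exists>i\<ge>N. dist x0 (xs i) \<le> r")
    case True
    then obtain r where "\<forall>N. \<exists>i\<ge>N. xs i \<in> cball x0 r" by auto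
    then have "infinite {i. xs i \<in> cball x0 r}" unfolding infinite_nat_iff_unbounded_le by simp
    then obtain k :: "nat \<Rightarrow> nat" where k: "strict_mono k" "\<And>i. xs (k i) \<in> cball x0 r"
      using infinite_enumerate by blast
    have "seq_compact (cball x0 r)" using proper[of "cball x0 r"] by (simp add: compact_eq_seq_compact_metric)
    then obtain x l where l: "strict_mono l" "((xs \<circ> k) \<circ> l) \<longlonglongrightarrow> x"
      using seq_compactE[of "cball x0 r" "xs \<circ> k"] k(2) by (metis comp_apply)
    have "limitin mtopology (Inl \<circ> ((xs \<circ> k) \<circ> l)) (Inl x) sequentially"
      by (rule continuous_map_limit[OF continuous_map_Inl]) (use l(2) in simp)
    moreover have "Inl \<circ> ((xs \<circ> k) \<circ> l) = \<sigma> \<circ> (k \<circ> l)" using xs by auto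
    ultimately show ?thesis
      using MCauchy_convergent_subsequence[OF \<sigma> strict_mono_o[OF k(1) l(1)]] by auto
  next
    case False
    have "xs \<in> gromov_seqs P"
      unfolding gromov_seqs_iff
    proof
      fix s
      obtain n :: nat where n: "max s 1 \<le> real n" using real_arch_simple by blast
      then have n1: "n \<ge> 1" by simp
      \<comment> \<open>Beyond \<open>r\<close>, a pair within distance 1 has product above
        \<open>s\<close> by (CP3). So an entourage pair far out has a large product whichever part
        of the entourage it comes from; \<open>n\<close> at least 1 keeps the metric part within
        distance 1.\<close>
      obtain r where r: "\<And>x y. P x y \<le> s \<Longrightarrow> dist x y \<le> 1 \<Longrightarrow> dist x0 x \<le> r" using cp3 by blast
      obtain N1 where N1: "\<And>i. i \<ge> N1 \<Longrightarrow> dist x0 (xs i) > r"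
        using False by (meson not_le)
      obtain e where e: "e > 0" "\<forall>p\<in>gromov_closure P. \<forall>q\<in>gromov_closure P.
          d p q < e \<longrightarrow> (p, q) \<in> gromov_entourage P n" using d_small[OF n1] by blast
      obtain N2 where N2: "\<And>i j. i \<ge> N2 \<Longrightarrow> j \<ge> N2 \<Longrightarrow> d (\<sigma> i) (\<sigma> j) < e"
        using \<sigma> e(1) unfolding MCauchy_def by meson
      have "P (xs i) (xs j) > s" if ij: "i \<ge> max N1 N2" "j \<ge> max N1 N2" for i j
      proof -
        have "(Inl (xs i), Inl (xs j)) \<in> gromov_entourage P n"
          using N2[of i j] ij e(2) Inl_closure unfolding xs by auto
        then show ?thesis
        proof (rule entourageE)
          assume "ext_product P (Inl (xs i)) (Inl (xs j)) > ereal (real n)"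
          then show ?thesis using n by (simp add: ext_product_Inl)
        next
          fix x y assume "Inl (xs i) = (Inl x :: 'a gromov_point)" "Inl (xs j) = (Inl y :: 'a gromov_point)"
            and "dist x y < 1 / real n"
          moreover have "1 / real n \<le> 1" using n1 by simp
          ultimately have "dist (xs i) (xs j) \<le> 1" by simp
          then show ?thesis using r[of "xs i" "xs j"] N1[of i] ij by fastforce
        qed
      qed
      then show "\<exists>N. \<forall>i\<ge>N. \<forall>j\<ge>N. P (xs i) (xs j) > s" by blast
    qed
    define c where "c = gromov_rel P `` {xs}"
    have c: "c \<in> gromov_boundary P"
      unfolding c_def gromov_boundary_def by (rule quotientI) fact
    have xsc: "xs \<in> c"
      unfolding c_def using equiv_class_self[OF equiv_gromov_rel \<open>xs \<in> gromov_seqs P\<close>] .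
    have cK: "Inr c \<in> gromov_closure P" using c unfolding gromov_closure_def by blast
    have "limitin mtopology \<sigma> (Inr c) sequentially"
      unfolding limitin_metric
    proof (intro conjI allI impI cK)
      fix e :: real assume "e > 0"
      then obtain n where n: "n \<ge> 1" "\<And>p q. (p, q) \<in> gromov_entourage P n \<Longrightarrow> d p q < e"
        using entourage_small by blast
      show "\<forall>\<^sub>F i in sequentially. \<sigma> i \<in> gromov_closure P \<and> d (\<sigma> i) (Inr c) < e"
        using entourage_seq[OF c xsc, of n] by eventually_elim (use n(2) xs Inl_closure in auto)
    qed
    then show ?thesis ..
  qed
qed

lemma compact_space_mtopology:
  assumes proper: "\<And>S :: 'a set. closed S \<Longrightarrow> bounded S \<Longrightarrow> compact S"
  shows "compact_space mtopology"
  using mcomplete_mtopology[OF proper] mtotally_bounded_closure_of[OF mtotally_bounded_range_Inl[OF proper]]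
  unfolding compact_space_eq_mcomplete_mtotally_bounded closure_of_range_Inl by blast

end

section \<open>The Higson compactification\<close>

text \<open>Restricted because the points of a product topology are extensional functions on the
  index set.\<close>

definition higson_eval :: "'a::metric_space \<Rightarrow> ('a \<Rightarrow> complex) \<Rightarrow> complex" where
  "higson_eval x = restrict (\<lambda>f. f x) (Collect higson_function)"

definition higson_product :: "(('a::metric_space \<Rightarrow> complex) \<Rightarrow> complex) topology" where
  "higson_product = product_topology (\<lambda>_. euclidean) (Collect higson_function)"

definition higson_space :: "(('a::metric_space \<Rightarrow> complex) \<Rightarrow> complex) topology" where
  "higson_space = subtopology higson_product (higson_product closure_of range higson_eval)"

lemma higson_eval_apply: "higson_function f \<Longrightarrow> higson_eval x f = f x"
  unfolding higson_eval_def by simp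

lemma topspace_higson_product: "topspace higson_product = extensional (Collect higson_function)"
  unfolding higson_product_def by (simp add: PiE_def)

lemma Hausdorff_higson_product: "Hausdorff_space higson_product"
  unfolding higson_product_def by (simp add: Hausdorff_space_product_topology)

lemma topspace_higson_space: "topspace higson_space = higson_product closure_of range higson_eval"
  unfolding higson_space_def using closure_of_subset_topspace by fastforce

lemma higson_space_extensional:
  "z \<in> topspace higson_space \<Longrightarrow> z \<in> extensional (Collect higson_function)"
  unfolding topspace_higson_space topspace_higson_product[symmetric]
  by (rule subsetD[OF closure_of_subset_topspace])

lemma higson_eval_in: "higson_eval x \<in> topspace higson_space"
proof -
  have "range higson_eval \<subseteq> topspace higson_product"
    unfolding topspace_higson_product higson_eval_def by auto
  then have "range higson_eval \<subseteq> higson_product closure_of range higson_eval"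
    by (rule closure_of_subset)
  then show ?thesis unfolding topspace_higson_space by blast
qed

lemma Hausdorff_higson_space: "Hausdorff_space higson_space"
  unfolding higson_space_def by (rule Hausdorff_space_subtopology[OF Hausdorff_higson_product])

text \<open>Each Higson function is bounded, so the evaluation image lies in a product of closed
  discs, which is compact by Tychonoff.\<close>

lemma compact_higson_space:
  "compact_space (higson_space :: (('a::metric_space \<Rightarrow> complex) \<Rightarrow> complex) topology)"
proof -
  have "\<exists>r. range f \<subseteq> cball 0 r" if "higson_function f" for f :: "'a \<Rightarrow> complex"
  proof -
    have "bounded (range f)" using that unfolding higson_function_def by simp
    then obtain r where "range f \<subseteq> ball 0 r" by (metis bounded_subset_ballD)
    then have "range f \<subseteq> cball 0 r" using ball_subset_cball by (rule subset_trans)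
    then show ?thesis ..
  qed
  then obtain r where r: "\<And>f :: 'a \<Rightarrow> complex. higson_function f \<Longrightarrow> range f \<subseteq> cball 0 (r f)" by metis
  define S where "S = PiE (Collect higson_function) (\<lambda>f :: 'a \<Rightarrow> complex. cball 0 (r f) :: complex set)"
  have S: "compactin higson_product S"
    unfolding higson_product_def S_def compactin_PiE by (intro disjI2 ballI)
      (simp only: compactin_euclidean_iff compact_cball)
  have "range (higson_eval :: 'a \<Rightarrow> _) \<subseteq> S"
  proof
    fix z assume "z \<in> range (higson_eval :: 'a \<Rightarrow> _)"
    then obtain x :: 'a where z: "z = higson_eval x" by blast
    have "f x \<in> cball 0 (r f)" if "higson_function f" for f using r[OF that] by blast
    then show "z \<in> S" unfolding z S_def higson_eval_def by (auto simp only: PiE_restrict restrict_PiE_iff mem_Collect_eq)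
  qed
  then have "higson_product closure_of range higson_eval \<subseteq> S"
    by (rule closure_of_minimal) (rule compactin_imp_closedin[OF Hausdorff_higson_product S])
  then have "compactin higson_product (higson_product closure_of range (higson_eval :: 'a \<Rightarrow> _))"
    by (rule closed_compactin[OF S]) simp
  then show ?thesis unfolding higson_space_def by (rule compact_space_subtopology)
qed

lemma closure_of_range_higson_eval:
  "higson_space closure_of range (higson_eval :: 'a::metric_space \<Rightarrow> _) = topspace higson_space"
proof -
  have "range (higson_eval :: 'a \<Rightarrow> _) \<subseteq> higson_product closure_of range higson_eval"
    using higson_eval_in unfolding topspace_higson_space by blast
  then show ?thesis
    unfolding topspace_higson_space unfolding higson_space_def closure_of_subtopology
    by (simp only: Int_absorb1 Int_absorb)
qed

lemma continuous_map_higson_space_apply: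
  assumes "higson_function f"
  shows "continuous_map higson_space euclidean (\<lambda>z. z f)"
  unfolding higson_space_def higson_product_def
  by (rule continuous_map_from_subtopology)
    (use continuous_map_product_projection[of f "Collect higson_function" "\<lambda>_. euclidean"] assms in simp)

lemma continuous_map_higson_eval: "continuous_map euclidean higson_space higson_eval"
proof -
  have "continuous_map euclidean higson_product higson_eval"
    unfolding higson_product_def continuous_map_componentwise
    by (auto simp: higson_eval_def higson_function_def)
  moreover have "higson_eval \<in> UNIV \<rightarrow> higson_product closure_of range higson_eval"
    using higson_eval_in unfolding topspace_higson_space by blast
  ultimately show ?thesis unfolding higson_space_def continuous_map_in_subtopology by simp
qed

section \<open>Higson functions separating points of X from closed sets\<close>

lemma higson_function_bounded_support:
  assumes "continuous_on UNIV f" "bounded (range f)" "bounded B" "\<And>x. x \<notin> B \<Longrightarrow> f x = 0"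
  shows "higson_function f"
  unfolding higson_function_def using assms by (metis diff_self norm_zero)

text \<open>The tent is nonzero exactly on \<open>ball x r\<close>, so the corresponding coordinate
  of the product recognizes that ball inside the evaluation image.\<close>

lemma higson_function_bump:
  assumes "r > 0"
  shows "higson_function (\<lambda>y. complex_of_real (max 0 (1 - dist x y / r)))"
proof (rule higson_function_bounded_support[where B="cball x r"])
  show "continuous_on UNIV (\<lambda>y. complex_of_real (max 0 (1 - dist x y / r)))"
    by (intro continuous_intros) (use assms in auto)
  show "bounded (range (\<lambda>y. complex_of_real (max 0 (1 - dist x y / r))))"
    by (rule boundedI[where B=1]) (use assms in auto)
  show "complex_of_real (max 0 (1 - dist x y / r)) = 0" if "y \<notin> cball x r" for y
    using that assms by (simp add: max_def field_simps)
qed simp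

text \<open>A tent of radius \<open>dist x y\<close> at \<open>x\<close> vanishes at
  \<open>y\<close>, which gives injectivity; the nonvanishing sets of tent coordinates, being open,
  give openness onto the image.\<close>

lemma embedding_map_higson_eval:
  "embedding_map euclidean higson_space (higson_eval :: 'a::metric_space \<Rightarrow> _)"
  unfolding embedding_map_def
proof (rule bijective_open_imp_homeomorphic_map)
  let ?R = "subtopology higson_space (higson_eval ` topspace (euclidean :: 'a topology))"
  have eval: "higson_eval y (\<lambda>y. complex_of_real (max 0 (1 - dist x y / r))) =
      complex_of_real (max 0 (1 - dist x y / r))" if "r > 0" for x y :: 'a and r
    by (rule higson_eval_apply[OF higson_function_bump[OF that]])
  have sep: "y \<in> ball x r" if r: "r > 0"
    and "higson_eval y (\<lambda>y. complex_of_real (max 0 (1 - dist x y / r))) \<noteq> 0" for x y :: 'a and r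
  proof -
    have "\<not> 1 - dist x y / r \<le> 0" using that(2) unfolding eval[OF r] by auto
    then show ?thesis using r by (simp add: field_simps)
  qed
  have bump: "higson_eval x (\<lambda>y. complex_of_real (max 0 (1 - dist x y / r))) \<noteq> 0"
    if "r > 0" for x :: 'a and r
    unfolding eval[OF that] by simp
  show "continuous_map euclidean ?R higson_eval"
    using continuous_map_higson_eval by (simp add: continuous_map_in_subtopology)
  show "higson_eval ` topspace euclidean = topspace ?R" using higson_eval_in by auto
  show "inj_on higson_eval (topspace (euclidean :: 'a topology))"
  proof (rule inj_onI, rule ccontr)
    fix x y :: 'a assume "higson_eval x = higson_eval y" "x \<noteq> y"
    then show False using bump[of "dist x y" x] sep[of "dist x y" y x] by simp
  qed
  show "open_map euclidean ?R higson_eval"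
    unfolding open_map_def
  proof (intro allI impI)
    fix U :: "'a set" assume "openin euclidean U"
    then have U: "open U" by simp
    have "\<exists>T. openin ?R T \<and> higson_eval x \<in> T \<and> T \<subseteq> higson_eval ` U" if "x \<in> U" for x
    proof -
      obtain r where r: "r > 0" "ball x r \<subseteq> U" using U \<open>x \<in> U\<close> openE by blast
      let ?b = "\<lambda>y. complex_of_real (max 0 (1 - dist x y / r))"
      let ?T = "{z \<in> topspace ?R. z ?b \<in> - {0}}"
      have "continuous_map ?R euclidean (\<lambda>z. z ?b)"
        by (intro continuous_map_from_subtopology continuous_map_higson_space_apply
            higson_function_bump r(1))
      then have "openin ?R ?T" by (rule openin_continuous_map_preimage) (simp add: open_Compl)
      moreover have "higson_eval x \<in> ?T" using bump[OF r(1)] higson_eval_in by auto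
      moreover have "?T \<subseteq> higson_eval ` U"
      proof
        fix z assume "z \<in> ?T"
        then obtain y :: 'a where y: "z = higson_eval y" "z ?b \<noteq> 0" by auto
        then have "y \<in> U" using sep[OF r(1), of y x] r(2) by blast
        then show "z \<in> higson_eval ` U" using y(1) by blast
      qed
      ultimately show ?thesis by blast
    qed
    then show "openin ?R (higson_eval ` U)" by (subst openin_subopen) blast
  qed
qed

text \<open>If \<open>g \<circ> higson_eval\<close> oscillated by \<open>\<epsilon>\<close> on pairs of \<open>R\<close>-close points leaving every
  ball, those pairs would accumulate at some \<open>(z, w)\<close> in the square of the Higson space.  All Higson
  functions agree on \<open>z\<close> and \<open>w\<close>, so \<open>z = w\<close>, but \<open>g z\<close> and \<open>g w\<close> differ by at least \<open>\<epsilon>\<close>.\<close>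

lemma higson_oscillation:
  fixes g :: "(('a::metric_space \<Rightarrow> complex) \<Rightarrow> complex) \<Rightarrow> complex"
  assumes g: "continuous_map higson_space euclidean g" and "\<epsilon> > 0" "R > 0"
  shows "\<exists>B. bounded B \<and> (\<forall>x y. x \<notin> B \<longrightarrow> y \<notin> B \<longrightarrow> dist x y < R \<longrightarrow>
    cmod (g (higson_eval x) - g (higson_eval y)) < \<epsilon>)"
proof (rule ccontr)
  assume no: "\<not> ?thesis"
  fix x0 :: 'a
  let ?H = "higson_space :: (('a \<Rightarrow> complex) \<Rightarrow> complex) topology"
  define S where "S k = {(higson_eval x, higson_eval y) | x y. x \<notin> cball x0 (real k) \<and>
      y \<notin> cball x0 (real k) \<and> dist x y < R \<and> \<epsilon> \<le> cmod (g (higson_eval x) - g (higson_eval y))}"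
    for k :: nat
  define C where "C k = prod_topology ?H ?H closure_of S k" for k
  have Stop: "S k \<subseteq> topspace (prod_topology ?H ?H)" for k
    unfolding S_def using higson_eval_in by auto
  have Sne: "S k \<noteq> {}" for k
  proof -
    have "\<not> (\<forall>x y. x \<notin> cball x0 (real k) \<longrightarrow> y \<notin> cball x0 (real k) \<longrightarrow> dist x y < R \<longrightarrow>
        cmod (g (higson_eval x) - g (higson_eval y)) < \<epsilon>)"
      using no bounded_cball by blast
    then show ?thesis unfolding S_def not_less[symmetric] by blast
  qed
  have "(\<Inter>k. C k) \<noteq> {}"
  proof (rule compact_space_imp_nest)
    show "compact_space (prod_topology ?H ?H)"
      by (simp add: compact_space_prod_topology compact_higson_space)
    show "closedin (prod_topology ?H ?H) (C k)" for k unfolding C_def by simp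
    show "C k \<noteq> {}" for k using closure_of_subset[OF Stop[of k]] Sne[of k] unfolding C_def by blast
    show "decseq C"
    proof (rule antimonoI)
      fix j k :: nat assume "j \<le> k"
      then have "S k \<subseteq> S j" unfolding S_def by fastforce
      then show "C k \<subseteq> C j" unfolding C_def by (rule closure_of_mono)
    qed
  qed
  then obtain z w where zw: "\<And>k. (z, w) \<in> prod_topology ?H ?H closure_of S k"
    unfolding C_def by fastforce
  have diff: "continuous_map (prod_topology ?H ?H) euclidean (\<lambda>zw. h (fst zw) - h (snd zw))"
    if h: "continuous_map ?H euclidean h" for h :: "_ \<Rightarrow> complex"
    using continuous_map_compose[OF continuous_map_fst h] continuous_map_compose[OF continuous_map_snd h]
    by (intro continuous_map_diff) (auto simp: o_def)
  have top: "z \<in> topspace ?H" "w \<in> topspace ?H"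
    using zw[of 0] closure_of_subset_topspace[of "prod_topology ?H ?H"] by fastforce+
  have far: "\<epsilon> \<le> cmod (g z - g w)"
  proof -
    let ?A = "{c :: complex. \<epsilon> \<le> cmod c}"
    have "closed ?A" by (intro closed_Collect_le continuous_intros)
    then have "closedin (prod_topology ?H ?H)
        {p \<in> topspace (prod_topology ?H ?H). g (fst p) - g (snd p) \<in> ?A}"
      by (intro closedin_continuous_map_preimage[OF diff[OF g]]) simp
    moreover have "g (fst p) - g (snd p) \<in> ?A" if "p \<in> S 0" for p
      using that unfolding S_def by auto
    ultimately have "g (fst (z, w)) - g (snd (z, w)) \<in> ?A"
      by (intro forall_in_closure_of[OF zw[of 0], where P="\<lambda>p. g (fst p) - g (snd p) \<in> ?A"])
    then show ?thesis by simp
  qed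
  have "z f = w f" if f: "higson_function f" for f
  proof -
    \<comment> \<open>For \<open>k\<close> so large that the ball contains the exceptional set
      \<open>B\<close>, the Higson estimate for \<open>f\<close> holds on all of \<open>S k\<close>;
      as a weak inequality it passes to the closure, hence to \<open>(z, w)\<close>.\<close>
    have "cmod (z f - w f) \<le> \<delta>" if "\<delta> > 0" for \<delta>
    proof -
      obtain B where B: "bounded B"
          "\<And>x y. x \<notin> B \<Longrightarrow> y \<notin> B \<Longrightarrow> dist x y < R \<Longrightarrow> cmod (f x - f y) < \<delta>"
        using f \<open>\<delta> > 0\<close> \<open>R > 0\<close> unfolding higson_function_def by blast
      obtain r where r: "B \<subseteq> ball x0 r" using bounded_subset_ballD[OF B(1)] by blast
      obtain k :: nat where "r \<le> real k" using real_arch_simple by blast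
      then have k: "B \<subseteq> cball x0 (real k)" using r by fastforce
      let ?A = "{c :: complex. cmod c \<le> \<delta>}"
      have "closed ?A" by (intro closed_Collect_le continuous_intros)
      then have "closedin (prod_topology ?H ?H)
          {p \<in> topspace (prod_topology ?H ?H). fst p f - snd p f \<in> ?A}"
        by (intro closedin_continuous_map_preimage[OF diff[OF continuous_map_higson_space_apply[OF f]]])
          simp
      moreover have "fst p f - snd p f \<in> ?A" if p: "p \<in> S k" for p
      proof -
        obtain x y where xy: "p = (higson_eval x, higson_eval y)" "x \<notin> B" "y \<notin> B" "dist x y < R"
          using p k unfolding S_def by blast
        then show ?thesis using B(2)[OF xy(2-4)] f by (simp add: higson_eval_apply)
      qed
      ultimately have "fst (z, w) f - snd (z, w) f \<in> ?A"
        by (intro forall_in_closure_of[OF zw[of k], where P="\<lambda>p. fst p f - snd p f \<in> ?A"])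
      then show ?thesis by simp
    qed
    then have "cmod (z f - w f) \<le> 0" by (rule field_le_epsilon) simp
    then show ?thesis by simp
  qed
  then have "z = w"
    using higson_space_extensional[OF top(1)] higson_space_extensional[OF top(2)]
    by (intro extensionalityI[of z "Collect higson_function" w]) auto
  then show False using far \<open>\<epsilon> > 0\<close> by simp
qed

lemma higson_function_compose_eval:
  assumes "continuous_map higson_space euclidean g"
  shows "higson_function (g \<circ> higson_eval)"
proof -
  have "compactin euclidean (g ` topspace higson_space)"
    using compact_higson_space assms unfolding compact_space_def by (rule image_compactin)
  then have "bounded (g ` topspace higson_space)" by (simp add: compact_imp_bounded)
  then have "bounded (range (g \<circ> higson_eval))"
    by (rule bounded_subset) (use higson_eval_in in auto)
  moreover have "continuous_on UNIV (g \<circ> higson_eval)"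
    using continuous_map_compose[OF continuous_map_higson_eval assms] by simp
  ultimately show ?thesis using higson_oscillation[OF assms] unfolding higson_function_def by simp
qed

text \<open>Restriction is injective because X is dense, takes values in the Higson functions by
  \<open>higson_function_compose_eval\<close>, and is onto because a Higson function is the
  restriction of its own coordinate projection.\<close>

lemma higson_compactification_higson_space: 
  "higson_compactification higson_space (higson_eval :: 'a::metric_space \<Rightarrow> _)"
  unfolding higson_compactification_def compactification_def
proof (intro conjI bij_betw_imageI compact_higson_space Hausdorff_higson_space
    embedding_map_higson_eval)
  show "higson_space closure_of higson_eval ` topspace (euclidean :: 'a topology) = topspace higson_space"
    using closure_of_range_higson_eval by simp
  let ?C = "{g \<in> extensional (topspace higson_space). continuous_map higson_space euclidean g}
    :: ((('a \<Rightarrow> complex) \<Rightarrow> complex) \<Rightarrow> complex) set"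
  show "inj_on (\<lambda>g. g \<circ> higson_eval) ?C"
  proof (rule inj_onI)
    fix g1 g2 assume g: "g1 \<in> ?C" "g2 \<in> ?C" and eq: "g1 \<circ> higson_eval = g2 \<circ> higson_eval"
    have "g1 z = g2 z" if "z \<in> topspace higson_space" for z
    proof (rule forall_in_closure_of_eq[where Y=euclidean and f=g1 and g=g2 and x=z])
      show "z \<in> higson_space closure_of range higson_eval"
        using that unfolding closure_of_range_higson_eval .
      show "g1 x = g2 x" if "x \<in> range higson_eval" for x
        using that eq by (auto simp: fun_eq_iff)
    qed (use g in auto)
    then show "g1 = g2" using g by (intro extensionalityI[of g1 "topspace higson_space"]) auto
  qed
  show "(\<lambda>g. g \<circ> higson_eval) ` ?C = Collect higson_function"
  proof (intro equalityI subsetI)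
    fix f assume "f \<in> (\<lambda>g. g \<circ> higson_eval) ` ?C"
    then show "f \<in> Collect higson_function" using higson_function_compose_eval by auto
  next
    fix f :: "'a \<Rightarrow> complex" assume "f \<in> Collect higson_function"
    then have f: "higson_function f" by simp
    let ?g = "restrict (\<lambda>z. z f) (topspace higson_space)"
    have "continuous_map higson_space euclidean ?g"
      by (rule continuous_map_eq[OF continuous_map_higson_space_apply[OF f]]) simp
    moreover have "f = ?g \<circ> higson_eval"
      using higson_eval_in by (auto simp: fun_eq_iff higson_eval_apply[OF f])
    ultimately show "f \<in> (\<lambda>g. g \<circ> higson_eval) ` ?C" by (intro image_eqI[of _ _ ?g]) auto
  qed
qed

section \<open>The map from the Higson compactification\<close>

context gromov_metric
begin

text \<open>The Kuratowski coordinate of \<open>q\<close>, made complex because Higson functions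
  are.\<close>

definition dist_fun :: "'a gromov_point \<Rightarrow> 'a \<Rightarrow> complex" where
  "dist_fun q x = complex_of_real (d q (Inl x))"

lemma cmod_dist_fun_diff:
  assumes "q \<in> gromov_closure P"
  shows "cmod (dist_fun q x - dist_fun q y) \<le> d (Inl x) (Inl y)"
proof -
  have "\<bar>d q (Inl x) - d q (Inl y)\<bar> \<le> d (Inl x) (Inl y)"
    using triangle[OF assms Inl_closure[of x] Inl_closure[of y]]
      triangle[OF assms Inl_closure[of y] Inl_closure[of x]] commute[of "Inl x" "Inl y"] by linarith
  then show ?thesis unfolding dist_fun_def by (metis norm_of_real of_real_diff)
qed

text \<open>By (CP3), \<open>R\<close>-close points far from the base point have a large product, so they are close in
  the metric of the Gromov compactification.\<close>

lemma d_Inl_far: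
  assumes "e > 0"
  shows "\<exists>r. \<forall>x y. dist x0 x > r \<longrightarrow> dist x y < R \<longrightarrow> d (Inl x) (Inl y) < e"
proof -
  obtain n where n: "n \<ge> 1" "\<And>p q. (p, q) \<in> gromov_entourage P n \<Longrightarrow> d p q < e"
    using entourage_small[OF assms] by blast
  obtain r where r: "\<And>x y. P x y \<le> real n \<Longrightarrow> dist x y \<le> R \<Longrightarrow> dist x0 x \<le> r" using cp3 by blast
  have "d (Inl x) (Inl y) < e" if "dist x0 x > r" "dist x y < R" for x y
  proof (rule n(2))
    have "P x y > real n" using r[of x y] that by fastforce
    then show "(Inl x, Inl y) \<in> gromov_entourage P n"
      unfolding gromov_entourage_def using Inl_closure by (simp add: ext_product_Inl)
  qed
  then show ?thesis by blast
qed

text \<open>Distance functions are 1-Lipschitz for \<open>d\<close>, so it suffices to control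
  \<open>d\<close> itself: \<open>d_Inl_near\<close> gives continuity, and \<open>d_Inl_far\<close>
  the vanishing oscillation.\<close>

lemma higson_function_dist_fun:
  assumes q: "q \<in> gromov_closure P"
  shows "higson_function (dist_fun q)"
  unfolding higson_function_def
proof (intro conjI allI impI)
  show "bounded (range (dist_fun q))"
    by (rule boundedI[where B=1]) (auto simp: dist_fun_def d_le_1)
  show "continuous_on UNIV (dist_fun q)"
    unfolding continuous_on_iff
  proof (intro ballI allI impI)
    fix x and e :: real assume "e > 0"
    then obtain r where r: "r > 0" "\<And>x y. dist x y < r \<Longrightarrow> d (Inl x) (Inl y) < e"
      using d_Inl_near by metis
    have "dist (dist_fun q y) (dist_fun q x) < e" if "dist y x < r" for y
      using cmod_dist_fun_diff[OF q, of y x] r(2)[OF that] by (simp add: dist_norm)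
    then show "\<exists>r>0. \<forall>y\<in>UNIV. dist y x < r \<longrightarrow> dist (dist_fun q y) (dist_fun q x) < e"
      using r(1) by blast
  qed
  fix e R :: real assume "e > 0" "R > 0"
  obtain r where r: "\<And>x y. dist x0 x > r \<Longrightarrow> dist x y < R \<Longrightarrow> d (Inl x) (Inl y) < e"
    using d_Inl_far[OF \<open>e > 0\<close>] by blast
  have "cmod (dist_fun q x - dist_fun q y) < e" if "x \<notin> cball x0 r" "dist x y < R" for x y
    using cmod_dist_fun_diff[OF q, of x y] r[of x y] that by simp
  then show "\<exists>B. bounded B \<and> (\<forall>x y. x \<notin> B \<longrightarrow> y \<notin> B \<longrightarrow> dist x y < R \<longrightarrow>
      cmod (dist_fun q x - dist_fun q y) < e)"
    using bounded_cball by blast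
qed

lemma continuous_map_d:
  assumes "q \<in> gromov_closure P"
  shows "continuous_map mtopology euclidean (d q)"
  using continuous_map_mdist[of mtopology "metric (gromov_closure P, d)" "\<lambda>_. q" "\<lambda>p. p"] assms
  by (simp add: continuous_map_id[unfolded id_def])

text \<open>The point assigned to \<open>z\<close> is a limit of \<open>Inl x\<close> along those \<open>x\<close> for which
  \<open>higson_eval x\<close> tends to \<open>z\<close>; it is found in the closure of the graph.\<close>

lemma higson_space_limit:
  assumes compact: "compact_space mtopology" and z: "z \<in> topspace higson_space"
  shows "\<exists>p\<in>gromov_closure P. \<forall>q\<in>gromov_closure P. z (dist_fun q) = complex_of_real (d q p)"
proof -
  let ?H = "higson_space :: (('a \<Rightarrow> complex) \<Rightarrow> complex) topology"
  let ?T = "prod_topology ?H mtopology"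
  let ?R = "range (\<lambda>x. (higson_eval x, Inl x :: 'a gromov_point))"
  have R: "?R \<subseteq> topspace ?T" using higson_eval_in Inl_closure by auto
  \<comment> \<open>Projection along a compact factor is closed, so the closure of the graph lies
    over a closed set containing the dense evaluation image, hence over every point of the Higson
    space.\<close>
  have "closedin ?H (fst ` (?T closure_of ?R))"
    using closed_map_fst[OF compact, of ?H] unfolding closed_map_def by simp
  moreover have "range (higson_eval :: 'a \<Rightarrow> _) \<subseteq> fst ` (?T closure_of ?R)"
    using closure_of_subset[OF R] by force
  ultimately have "topspace ?H \<subseteq> fst ` (?T closure_of ?R)"
    unfolding closure_of_range_higson_eval[symmetric] by (intro closure_of_minimal)
  then obtain p where p: "(z, p) \<in> ?T closure_of ?R" using z by force
  then have "(z, p) \<in> topspace ?T" using closure_of_subset_topspace by (rule rev_subsetD)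
  then have pK: "p \<in> gromov_closure P" by simp
  have "z (dist_fun q) = complex_of_real (d q p)" if q: "q \<in> gromov_closure P" for q
  proof -
    note hf = higson_function_dist_fun[OF q]
    have "fst (z, p) (dist_fun q) = complex_of_real (d q (snd (z, p)))"
    proof (rule forall_in_closure_of_eq[OF p, where Y=euclidean and
          f="\<lambda>zp. fst zp (dist_fun q)" and g="\<lambda>zp. complex_of_real (d q (snd zp))"])
      show "continuous_map ?T euclidean (\<lambda>zp. fst zp (dist_fun q))"
        using continuous_map_compose[OF continuous_map_fst continuous_map_higson_space_apply[OF hf]]
        by (simp add: o_def)
      have "continuous_map euclidean euclidean complex_of_real"
        by (simp add: continuous_intros)
      from continuous_map_compose[OF continuous_map_compose[OF continuous_map_snd continuous_map_d[OF q]] this]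
      show "continuous_map ?T euclidean (\<lambda>zp. complex_of_real (d q (snd zp)))"
        by (simp add: o_def)
      show "fst x (dist_fun q) = complex_of_real (d q (snd x))" if "x \<in> ?R" for x
        using that by (auto simp: higson_eval_apply[OF hf] dist_fun_def)
    qed simp
    then show ?thesis by simp
  qed
  then show ?thesis using pK by blast
qed

text \<open>Continuity at \<open>z\<close> needs only the coordinate of \<open>F z\<close>: its
  value at \<open>w\<close> is the distance from \<open>F z\<close> to \<open>F w\<close>. Over X
  the coordinate of \<open>Inl x\<close> has the value 0, which forces the image to be
  \<open>Inl x\<close>.\<close>

lemma ex_higson_map:
  assumes compact: "compact_space mtopology"
  shows "\<exists>F. continuous_map higson_space mtopology F \<and> (\<forall>x. F (higson_eval x) = Inl x)"
proof -
  obtain F where F: "\<And>z. z \<in> topspace higson_space \<Longrightarrow> F z \<in> gromov_closure P"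
      "\<And>z q. z \<in> topspace higson_space \<Longrightarrow> q \<in> gromov_closure P \<Longrightarrow>
         z (dist_fun q) = complex_of_real (d q (F z))"
    using higson_space_limit[OF compact] by metis
  have "continuous_map higson_space mtopology F"
    unfolding continuous_map_to_metric
  proof (intro ballI allI impI)
    fix z :: "('a \<Rightarrow> complex) \<Rightarrow> complex" and e :: real
    assume z: "z \<in> topspace higson_space" and "e > 0"
    let ?U = "{w \<in> topspace higson_space. w (dist_fun (F z)) \<in> ball 0 e}"
    have "openin higson_space ?U"
      by (rule openin_continuous_map_preimage[OF continuous_map_higson_space_apply])
        (use higson_function_dist_fun F(1)[OF z] in auto)
    moreover have "z \<in> ?U" using z F(2)[OF z F(1)[OF z]] F(1)[OF z] \<open>e > 0\<close> by simp
    moreover have "F w \<in> mball (F z) e" if w: "w \<in> ?U" for w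
    proof -
      have "w (dist_fun (F z)) = complex_of_real (d (F z) (F w))"
        using F(2)[of w "F z"] F(1)[OF z] w by simp
      then show ?thesis using w F(1)[of w] F(1)[OF z] by (simp add: norm_of_real)
    qed
    ultimately show "\<exists>U. openin higson_space U \<and> z \<in> U \<and> (\<forall>w\<in>U. F w \<in> mball (F z) e)" by blast
  qed
  moreover have "F (higson_eval x) = Inl x" for x
  proof -
    have "complex_of_real (d (Inl x) (F (higson_eval x))) = complex_of_real (d (Inl x) (Inl x))"
      using F(2)[OF higson_eval_in Inl_closure, of x x]
      by (simp add: higson_eval_apply[OF higson_function_dist_fun[OF Inl_closure]] dist_fun_def)
    then have "d (Inl x) (F (higson_eval x)) = 0" using Inl_closure by simp
    then show ?thesis using F(1)[OF higson_eval_in, of x] Inl_closure by simp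
  qed
  ultimately show ?thesis by blast
qed

lemma coarse_compactification_mtopology:
  assumes proper: "\<And>S :: 'a set. closed S \<Longrightarrow> bounded S \<Longrightarrow> compact S"
  shows "coarse_compactification mtopology (Inl :: 'a \<Rightarrow> 'a gromov_point)"
  unfolding coarse_compactification_def compactification_def
proof (intro conjI)
  show "compact_space mtopology" by (rule compact_space_mtopology[OF proper])
  show "Hausdorff_space mtopology" by (rule Hausdorff_space_mtopology)
  show "embedding_map euclidean mtopology (Inl :: 'a \<Rightarrow> 'a gromov_point)" by (rule embedding_map_Inl)
  show "mtopology closure_of Inl ` topspace (euclidean :: 'a topology) = topspace mtopology"
    using closure_of_range_Inl by simp
  show "metrizable_space mtopology" by (rule metrizable_space_mtopology)
  show "\<exists>(H :: (('a \<Rightarrow> complex) \<Rightarrow> complex) topology) h f.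
      higson_compactification H h \<and> continuous_map H mtopology f \<and> (\<forall>x. f (h x) = Inl x)"
    using higson_compactification_higson_space ex_higson_map[OF compact_space_mtopology[OF proper]]
    by blast
qed

end

theorem proposition4p5:
  fixes x0 :: "'a::metric_space" and P :: "'a \<Rightarrow> 'a \<Rightarrow> real"
  assumes proper: "\<And>S :: 'a set. closed S \<Longrightarrow> bounded S \<Longrightarrow> compact S"
    and controlled: "controlled_product x0 P"
  shows "coarse_compactification (gromov_topology P) (Inl :: 'a \<Rightarrow> 'a gromov_point) \<and>
         corona TYPE('a) (subtopology (gromov_topology P) (Inr ` gromov_boundary P))"
proof -
  interpret controlled x0 P by (rule controlled_product_imp_controlled[OF controlled])
  obtain d where "gromov_metric x0 P d" using ex_gromov_metric by blast
  then interpret gromov_metric x0 P d .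
  have coarse: "coarse_compactification (gromov_topology P) (Inl :: 'a \<Rightarrow> 'a gromov_point)"
    using coarse_compactification_mtopology[OF proper] unfolding mtopology_eq_gromov_topology .
  have "Inr ` gromov_boundary P = topspace (gromov_topology P) - range Inl"
    unfolding topspace_gromov_topology gromov_closure_def by blast
  with coarse show ?thesis unfolding corona_def by auto
qed

end
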